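(* Let $\mathcal A=\mathcal A(\Sigma)$ be a cluster algebra, $H\le\mathrm{Aut}\,\mathcal A$, and let $\mathcal A(\Sigma_1)$ be a cluster subalgebra of $\mathcal A$ which is maximal (under inclusion) among cluster subalgebras of $\mathcal A$ contained in $\mathcal A^H$. (i) If $\mathcal A^H=\mathcal A(\Sigma_1)$, then the orbit $Hz$ is infinite for every $z\in\mathcal A\setminus\mathcal A(\Sigma_1)$ which can be written as a Laurent polynomial with positive coefficients in the variables of some cluster. (ii) Conversely, $\mathcal A^H=\mathcal A(\Sigma_1)$ holds if either (a) $\mathcal A$ has a stable monomial basis with unique expression and $|Hz|=+\infty$ for every cluster variable $z\in\mathcal A\setminus\mathcal A(\Sigma_1)$; or (b) $\mathcal A$ has a $\mathcal D$-stable basis and $|Hz|=+\infty$ for every cluster variable or quasi cluster variable $z\in\mathcal A\setminus\mathcal A(\Sigma_1)$.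
   Context: Cluster algebras: a seed is $\Sigma=(\mathbf x_{ex},\mathbf x_{fr},\widetilde B)$ with exchange variables $\mathbf x_{ex}$ and frozen variables $\mathbf x_{fr}$, $\widetilde B$ an $m\times n$ integer matrix with skew-symmetrizable upper part; $\mathcal A(\Sigma)$ is the $\mathbb Q$-algebra generated by all cluster variables of seeds mutation-equivalent to $\Sigma$; $\mathcal X$ denotes the set of all cluster variables, $R$ the polynomial ring over $\mathbb Q$ in the frozen variables. A cluster automorphism is an algebra automorphism mapping some extended cluster onto an extended cluster (exchange to exchange variables) and commuting with mutations; $\mathrm{Aut}\,\mathcal A$ is their group, $\mathcal A^H=\{z:f(z)=z\ \forall f\in H\}$. Cluster subalgebras are $\mathcal A(\Sigma')\subseteq\mathcal A$ with $\Sigma'=\Sigma_{I_0,I_1}$ a mixing-type sub-seed (remove $I_1\subseteq\mathbf x_{ex}\cup\mathbf x_{fr}$, freeze $I_0\subseteq \mathbf x_{ex}$, $I_0\cap I_1=\emptyset$, restrict the matrix) of a seed of $\mathcal A$ with $b_{xy}=0$ for $x\in I_1$, $y\in\mathbf x_{ex}\setminus(I_0\cup I_1)$. Stable monomial basis: a $\mathbb Q$-basis $W$ of $\mathcal A$ consisting of monomials in cluster variables with $f(W)\subseteq W$ for all $f\in\mathrm{Aut}\,\mathcal A$. It has unique expression if whenever $x_{11}^{k_{11}}\cdots x_{1s_1}^{k_{1s_1}}=x_{21}^{k_{21}}\cdots x_{2s_2}^{k_{2s_2}}$ for two elements of $W$ (each written with distinct cluster variables and positive exponents), then $s_1=s_2$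 and there is a permutation $\sigma$ with $x_{1j}=x_{2\sigma(j)}$ for all $j$. $\mathcal D$-stable basis: choose a set $C_q\subseteq\mathcal A$ of elements each expressible as a Laurent polynomial with positive coefficients in some cluster, and a set $\mathcal D$ of subsets of $C_q\cup\mathcal X$ such that $U\cap\mathcal X$ is contained in a cluster for each $U\in\mathcal D$. For $z\in C_q\cup\mathcal X$, $k\in\mathbb Z_{>0}$, let $\langle k,z\rangle=z^k$ if $z\in\mathcal X$ and $\langle k,z\rangle=P_k(z)$ for a fixed $P_k\in R[z]$ otherwise. Suppose for all $f\in\mathrm{Aut}\,\mathcal A$: (a) $f(\langle k,z\rangle)=\langle k,f(z)\rangle$ for all $k$ and all $z$ in members of $\mathcal D$; (b) $f(U)\in\mathcal D$ for $U\in\mathcal D$; (c) $W=\bigcup_{U\in\mathcal D}\{\prod_{x\in U'}\langle k_x,x\rangle: U'\subseteq U, k_x\in\mathbb Z_{>0}\}$ is a $\mathbb Q$-basis of $\mathcal A$, and products over different sets $U_1\ne U_2$ are different. Then $W$ is a $\mathcal D$-stable basis, and elements of $C_q$ are called quasi cluster variables. *)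

theory Defs
  imports "HOL-Computational_Algebra.Polynomial"
begin

text \<open>A seed is indexed by an abstract index type 'i: exchange indices, frozen
indices, the (extended) cluster as a map from indices to the ambient field 'a
(a field of characteristic 0 playing the role of the ambient field of rational
functions), and the exchange matrix (entries b i j; only rows in ex \<union> fr and
columns in ex are relevant).\<close>

datatype ('i, 'a) seed =
  Seed (sex: "'i set") (sfr: "'i set") (svar: "'i \<Rightarrow> 'a") (smat: "'i \<Rightarrow> 'i \<Rightarrow> int")

definition sidx :: "('i, 'a) seed \<Rightarrow> 'i set" where
  "sidx S = sex S \<union> sfr S"

definition mut_mat :: "'i \<Rightarrow> ('i \<Rightarrow> 'i \<Rightarrow> int) \<Rightarrow> ('i \<Rightarrow> 'i \<Rightarrow> int)" where
  "mut_mat k b = (\<lambda>i j. if i = k \<or> j = k then - b i j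
                         else b i j + sgn (b i k) * max (b i k * b k j) 0)"

definition mut_var :: "'i \<Rightarrow> ('i, 'a::field) seed \<Rightarrow> 'a" where
  "mut_var k S =
     ((\<Prod>i\<in>sidx S. svar S i ^ nat (smat S i k))
      + (\<Prod>i\<in>sidx S. svar S i ^ nat (- smat S i k))) / svar S k"

definition mutate :: "'i \<Rightarrow> ('i, 'a::field) seed \<Rightarrow> ('i, 'a) seed" where
  "mutate k S = Seed (sex S) (sfr S) ((svar S)(k := mut_var k S)) (mut_mat k (smat S))"

inductive reach :: "('i, 'a::field) seed \<Rightarrow> ('i, 'a) seed \<Rightarrow> bool" for S0 where
  refl: "reach S0 S0"
| step: "reach S0 S \<Longrightarrow> k \<in> sex S \<Longrightarrow> reach S0 (mutate k S)"

definition skew_symmetrizable :: "'i set \<Rightarrow> ('i \<Rightarrow> 'i \<Rightarrow> int) \<Rightarrow> bool" where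
  "skew_symmetrizable E b \<longleftrightarrow>
     (\<exists>d :: 'i \<Rightarrow> int. (\<forall>i\<in>E. d i > 0) \<and> (\<forall>i\<in>E. \<forall>j\<in>E. d i * b i j = - (d j * b j i)))"

definition alg_indep :: "'i set \<Rightarrow> ('i \<Rightarrow> 'a::field_char_0) \<Rightarrow> bool" where
  "alg_indep I x \<longleftrightarrow>
     (\<forall>(T :: ('i \<Rightarrow> nat) set) (c :: ('i \<Rightarrow> nat) \<Rightarrow> rat).
        finite T \<longrightarrow> (\<forall>e\<in>T. \<forall>i. i \<notin> I \<longrightarrow> e i = 0) \<longrightarrow>
        (\<Sum>e\<in>T. of_rat (c e) * (\<Prod>i\<in>I. x i ^ e i)) = 0 \<longrightarrow> (\<forall>e\<in>T. c e = 0))"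

definition is_seed :: "('i, 'a::field_char_0) seed \<Rightarrow> bool" where
  "is_seed S \<longleftrightarrow> finite (sex S) \<and> finite (sfr S) \<and> sex S \<inter> sfr S = {}
     \<and> inj_on (svar S) (sidx S) \<and> alg_indep (sidx S) (svar S)
     \<and> skew_symmetrizable (sex S) (smat S)"

inductive_set qalg_gen :: "'a::field_char_0 set \<Rightarrow> 'a set" for G where
  gen: "x \<in> G \<Longrightarrow> x \<in> qalg_gen G"
| rat: "of_rat q \<in> qalg_gen G"
| add: "x \<in> qalg_gen G \<Longrightarrow> y \<in> qalg_gen G \<Longrightarrow> x + y \<in> qalg_gen G"
| mult: "x \<in> qalg_gen G \<Longrightarrow> y \<in> qalg_gen G \<Longrightarrow> x * y \<in> qalg_gen G"

definition clvars :: "('i, 'a::field_char_0) seed \<Rightarrow> 'a set" where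
  "clvars S0 = {svar S i | S i. reach S0 S \<and> i \<in> sidx S}"

definition clusterAlg :: "('i, 'a::field_char_0) seed \<Rightarrow> 'a set" where
  "clusterAlg S0 = qalg_gen (clvars S0)"

definition frozenRing :: "('i, 'a::field_char_0) seed \<Rightarrow> 'a set" where
  "frozenRing S0 = qalg_gen (svar S0 ` sfr S0)"

definition is_cluster_aut :: "('i, 'a::field_char_0) seed \<Rightarrow> ('a \<Rightarrow> 'a) \<Rightarrow> bool" where
  "is_cluster_aut S0 f \<longleftrightarrow>
     bij_betw f (clusterAlg S0) (clusterAlg S0)
     \<and> (\<forall>x\<in>clusterAlg S0. \<forall>y\<in>clusterAlg S0. f (x + y) = f x + f y \<and> f (x * y) = f x * f y)
     \<and> (\<forall>q x. x \<in> clusterAlg S0 \<longrightarrow> f (of_rat q * x) = of_rat q * f x)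
     \<and> f 1 = 1
     \<and> (\<exists>S S'. reach S0 S \<and> reach S0 S'
          \<and> f ` (svar S ` sidx S) = svar S' ` sidx S'
          \<and> f ` (svar S ` sex S) = svar S' ` sex S'
          \<and> (\<forall>k\<in>sex S. \<forall>k'\<in>sex S'. svar S' k' = f (svar S k) \<longrightarrow>
                 f (mut_var k S) = mut_var k' S'))"

definition cluster_auts :: "('i, 'a::field_char_0) seed \<Rightarrow> ('a \<Rightarrow> 'a) set" where
  "cluster_auts S0 = {f. is_cluster_aut S0 f}"

text \<open>H is a subgroup of Aut A (automorphisms compared as maps on A).\<close>
definition aut_subgroup :: "('i, 'a::field_char_0) seed \<Rightarrow> ('a \<Rightarrow> 'a) set \<Rightarrow> bool" where
  "aut_subgroup S0 H \<longleftrightarrow> H \<subseteq> cluster_auts S0 \<and> H \<noteq> {}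
     \<and> (\<forall>f\<in>H. \<forall>g\<in>H. f \<circ> g \<in> H)
     \<and> (\<forall>f\<in>H. \<exists>g\<in>H. \<forall>z\<in>clusterAlg S0. g (f z) = z)"

definition fixed_alg :: "('i, 'a::field_char_0) seed \<Rightarrow> ('a \<Rightarrow> 'a) set \<Rightarrow> 'a set" where
  "fixed_alg S0 H = {z \<in> clusterAlg S0. \<forall>f\<in>H. f z = z}"

definition orbit :: "('a \<Rightarrow> 'a) set \<Rightarrow> 'a \<Rightarrow> 'a set" where
  "orbit H z = (\<lambda>f. f z) ` H"

definition subseed :: "('i, 'a) seed \<Rightarrow> 'i set \<Rightarrow> 'i set \<Rightarrow> ('i, 'a) seed" where
  "subseed S I0 I1 = Seed (sex S - (I0 \<union> I1)) ((sfr S \<union> I0) - I1) (svar S) (smat S)"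

definition is_cluster_subseed :: "('i, 'a::field_char_0) seed \<Rightarrow> ('i, 'a) seed \<Rightarrow> bool" where
  "is_cluster_subseed S0 S' \<longleftrightarrow>
     (\<exists>S I0 I1. reach S0 S \<and> I0 \<subseteq> sex S \<and> I1 \<subseteq> sidx S \<and> I0 \<inter> I1 = {}
        \<and> (\<forall>x\<in>I1. \<forall>y\<in>sex S - (I0 \<union> I1). smat S x y = 0)
        \<and> S' = subseed S I0 I1)"

definition is_cluster_subalgebra :: "('i, 'a::field_char_0) seed \<Rightarrow> 'a set \<Rightarrow> bool" where
  "is_cluster_subalgebra S0 B \<longleftrightarrow>
     (\<exists>S'. is_cluster_subseed S0 S' \<and> B = clusterAlg S' \<and> B \<subseteq> clusterAlg S0)"

definition pos_laurent_in :: "('i, 'a::field_char_0) seed \<Rightarrow> 'a \<Rightarrow> bool" where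
  "pos_laurent_in S z \<longleftrightarrow>
     (\<exists>(T :: ('i \<Rightarrow> int) set) (c :: ('i \<Rightarrow> int) \<Rightarrow> rat).
        finite T \<and> (\<forall>e\<in>T. c e > 0)
        \<and> z = (\<Sum>e\<in>T. of_rat (c e) * (\<Prod>i\<in>sidx S. svar S i powi e i)))"

definition pos_laurent :: "('i, 'a::field_char_0) seed \<Rightarrow> 'a \<Rightarrow> bool" where
  "pos_laurent S0 z \<longleftrightarrow> (\<exists>S. reach S0 S \<and> pos_laurent_in S z)"

definition qbasis :: "'a::field_char_0 set \<Rightarrow> 'a set \<Rightarrow> bool" where
  "qbasis V W \<longleftrightarrow> W \<subseteq> V
     \<and> (\<forall>T (c :: 'a \<Rightarrow> rat). finite T \<longrightarrow> T \<subseteq> W \<longrightarrow>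
          (\<Sum>t\<in>T. of_rat (c t) * t) = 0 \<longrightarrow> (\<forall>t\<in>T. c t = 0))
     \<and> (\<forall>v\<in>V. \<exists>T (c :: 'a \<Rightarrow> rat). finite T \<and> T \<subseteq> W \<and> v = (\<Sum>t\<in>T. of_rat (c t) * t))"

definition monomial_expr :: "'a::field_char_0 set \<Rightarrow> 'a \<Rightarrow> 'a set \<Rightarrow> ('a \<Rightarrow> nat) \<Rightarrow> bool" where
  "monomial_expr X w Y k \<longleftrightarrow> finite Y \<and> Y \<subseteq> X \<and> (\<forall>x\<in>Y. k x > 0) \<and> w = (\<Prod>x\<in>Y. x ^ k x)"

definition stable_monomial_basis :: "('i, 'a::field_char_0) seed \<Rightarrow> 'a set \<Rightarrow> bool" where
  "stable_monomial_basis S0 W \<longleftrightarrow>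
     qbasis (clusterAlg S0) W
     \<and> (\<forall>w\<in>W. \<exists>Y k. monomial_expr (clvars S0) w Y k)
     \<and> (\<forall>f\<in>cluster_auts S0. f ` W \<subseteq> W)"

definition unique_expression :: "('i, 'a::field_char_0) seed \<Rightarrow> 'a set \<Rightarrow> bool" where
  "unique_expression S0 W \<longleftrightarrow>
     (\<forall>w\<in>W. \<forall>Y1 k1 Y2 k2. monomial_expr (clvars S0) w Y1 k1 \<longrightarrow>
                          monomial_expr (clvars S0) w Y2 k2 \<longrightarrow> Y1 = Y2)"

definition bracket :: "('i, 'a::field_char_0) seed \<Rightarrow> (nat \<Rightarrow> 'a poly) \<Rightarrow> nat \<Rightarrow> 'a \<Rightarrow> 'a" where
  "bracket S0 P k z = (if z \<in> clvars S0 then z ^ k else poly (P k) z)"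

definition Dbasis_elems :: "('i, 'a::field_char_0) seed \<Rightarrow> 'a set set \<Rightarrow> (nat \<Rightarrow> 'a poly) \<Rightarrow> 'a set" where
  "Dbasis_elems S0 D P =
     {\<Prod>x\<in>U'. bracket S0 P (\<kappa> x) x | U U' \<kappa>. U \<in> D \<and> U' \<subseteq> U \<and> finite U' \<and> (\<forall>x\<in>U'. \<kappa> x > 0)}"

definition D_stable_basis ::
  "('i, 'a::field_char_0) seed \<Rightarrow> 'a set \<Rightarrow> 'a set set \<Rightarrow> (nat \<Rightarrow> 'a poly) \<Rightarrow> bool" where
  "D_stable_basis S0 Cq D P \<longleftrightarrow>
     Cq \<subseteq> clusterAlg S0 \<and> (\<forall>z\<in>Cq. pos_laurent S0 z)
     \<and> (\<forall>U\<in>D. U \<subseteq> Cq \<union> clvars S0 \<and> (\<exists>S. reach S0 S \<and> U \<inter> clvars S0 \<subseteq> svar S ` sidx S))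
     \<and> (\<forall>k i. coeff (P k) i \<in> frozenRing S0)
     \<and> (\<forall>f\<in>cluster_auts S0.
          (\<forall>k>0. \<forall>U\<in>D. \<forall>z\<in>U. f (bracket S0 P k z) = bracket S0 P k (f z))
          \<and> (\<forall>U\<in>D. f ` U \<in> D))
     \<and> qbasis (clusterAlg S0) (Dbasis_elems S0 D P)
     \<and> (\<forall>U1 U2 U1' U2' \<kappa>1 \<kappa>2. U1 \<in> D \<longrightarrow> U2 \<in> D \<longrightarrow> U1' \<subseteq> U1 \<longrightarrow> U2' \<subseteq> U2
          \<longrightarrow> finite U1' \<longrightarrow> finite U2' \<longrightarrow> (\<forall>x\<in>U1'. \<kappa>1 x > 0) \<longrightarrow> (\<forall>x\<in>U2'. \<kappa>2 x > 0)
          \<longrightarrow> (\<Prod>x\<in>U1'. bracket S0 P (\<kappa>1 x) x) = (\<Prod>x\<in>U2'. bracket S0 P (\<kappa>2 x) x)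
          \<longrightarrow> U1' = U2')"

end

theory Submission
  imports Defs
begin

text \<open>
  For (i), let \<open>z\<close> have a finite orbit. The elementary symmetric functions of the orbit are
  \<open>H\<close>-invariant, so they lie in the field \<open>K\<close> generated by the cluster \<open>x\<^sub>J\<close> of the subseed, and \<open>z\<close> is
  algebraic over \<open>K\<close>. As \<open>z\<close> lies in the field generated by an extended cluster containing \<open>x\<^sub>J\<close>,
  which is purely transcendental over \<open>K\<close>, it lies in \<open>K\<close>; being a quotient of invariant elements
  it is then invariant itself.

  For (ii), \<open>H\<close> permutes the basis, hence the finite support of every invariant element, so every
  basis element that occurs has a finite orbit. As a basis element determines the set of its
  (quasi) cluster variables, these have finite orbits too. In case (a) one needs that cluster
  automorphisms preserve the set of all cluster variables: compatibility with the mutations of one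
  seed forces the exchange matrices to agree up to a sign for each column, and this persists under
  mutation. In case (b) the frozen variables enter through the coefficients of \<open>P\<^sub>k\<close>; they are
  permuted by automorphisms, so they have finite orbits.
\<close>

section \<open>Algebras and fields generated by a set\<close>

lemma qalg_gen_0 [simp]: "0 \<in> qalg_gen G"
  using qalg_gen.rat[of 0 G] by simp

lemma qalg_gen_1 [simp]: "1 \<in> qalg_gen G"
  using qalg_gen.rat[of 1 G] by simp

lemma qalg_gen_uminus: "x \<in> qalg_gen G \<Longrightarrow> - x \<in> qalg_gen G"
  using qalg_gen.mult[OF qalg_gen.rat[of "-1"], of x G] by (simp add: of_rat_minus)

lemma qalg_gen_power: "x \<in> qalg_gen G \<Longrightarrow> x ^ n \<in> qalg_gen G"
  by (induction n) (auto intro: qalg_gen.mult)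

lemma qalg_gen_sum: "(\<And>i. i \<in> I \<Longrightarrow> g i \<in> qalg_gen G) \<Longrightarrow> sum g I \<in> qalg_gen G"
  by (induction I rule: infinite_finite_induct) (auto intro: qalg_gen.add)

lemma qalg_gen_prod: "(\<And>i. i \<in> I \<Longrightarrow> g i \<in> qalg_gen G) \<Longrightarrow> prod g I \<in> qalg_gen G"
  by (induction I rule: infinite_finite_induct) (auto intro: qalg_gen.mult)

lemma qalg_gen_poly:
  "(\<And>i. coeff p i \<in> qalg_gen G) \<Longrightarrow> x \<in> qalg_gen G \<Longrightarrow> poly p x \<in> qalg_gen G"
  unfolding poly_altdef by (intro qalg_gen_sum qalg_gen.mult qalg_gen_power)

lemma qalg_gen_least:
  assumes "G \<subseteq> qalg_gen G'" shows "qalg_gen G \<subseteq> qalg_gen G'"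
proof
  fix x assume "x \<in> qalg_gen G"
  then show "x \<in> qalg_gen G'"
    by induction (use assms in \<open>auto intro: qalg_gen.intros\<close>)
qed

lemma qalg_gen_mono: "G \<subseteq> G' \<Longrightarrow> qalg_gen G \<subseteq> qalg_gen G'"
  by (rule qalg_gen_least) (auto intro: qalg_gen.gen)

text \<open>Separates one generator \<open>t\<close> from the rest, so that the variables of a
  cluster can be adjoined or removed one at a time.\<close>

lemma qalg_gen_insert_poly:
  assumes "z \<in> qalg_gen (insert t G)"
  obtains p where "\<And>i. coeff p i \<in> qalg_gen G" "z = poly p t"
proof -
  have "\<exists>p. (\<forall>i. coeff p i \<in> qalg_gen G) \<and> z = poly p t"
    using assms
  proof induction
    case (gen x)
    show ?case
    proof (cases "x = t")
      case True
      then show ?thesis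
        by (intro exI[of _ "[:0, 1:]"]) (auto simp: coeff_pCons split: nat.split)
    next
      case False
      then have "x \<in> G" using gen by simp
      then show ?thesis
        by (intro exI[of _ "[:x:]"]) (auto simp: coeff_pCons qalg_gen.gen split: nat.split)
    qed
  next
    case (rat q)
    show ?case
      by (intro exI[of _ "[:of_rat q:]"]) (auto simp: coeff_pCons qalg_gen.rat split: nat.split)
  next
    case (add x y)
    then obtain p q where "\<forall>i. coeff p i \<in> qalg_gen G" "x = poly p t"
      "\<forall>i. coeff q i \<in> qalg_gen G" "y = poly q t" by blast
    then show ?case by (intro exI[of _ "p + q"]) (auto intro: qalg_gen.add)
  next
    case (mult x y)
    then obtain p q where "\<forall>i. coeff p i \<in> qalg_gen G" "x = poly p t"
      "\<forall>i. coeff q i \<in> qalg_gen G" "y = poly q t" by blast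
    then show ?case
      by (intro exI[of _ "p * q"]) (auto simp: coeff_mult intro!: qalg_gen_sum qalg_gen.mult)
  qed
  then show ?thesis using that by blast
qed

text \<open>The subfield Q(G) of the ambient field. The case \<open>b = 0\<close> is harmless:
  division by zero gives 0, which belongs to the field anyway.\<close>

definition qfield_gen :: "'a::field_char_0 set \<Rightarrow> 'a set" where
  "qfield_gen G = {a / b | a b. a \<in> qalg_gen G \<and> b \<in> qalg_gen G}"

lemma qfield_genI: "a \<in> qalg_gen G \<Longrightarrow> b \<in> qalg_gen G \<Longrightarrow> a / b \<in> qfield_gen G"
  unfolding qfield_gen_def by blast

lemma qalg_gen_subset_qfield_gen: "qalg_gen G \<subseteq> qfield_gen G"
  using qfield_genI[of _ G 1] by auto

lemma qfield_gen_mono: "G \<subseteq> G' \<Longrightarrow> qfield_gen G \<subseteq> qfield_gen G'"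
  unfolding qfield_gen_def using qalg_gen_mono by blast

lemma qfield_gen_0 [simp]: "0 \<in> qfield_gen G"
  and qfield_gen_1 [simp]: "1 \<in> qfield_gen G"
  using qalg_gen_subset_qfield_gen[of G] by auto

lemma qfield_gen_gen: "x \<in> G \<Longrightarrow> x \<in> qfield_gen G"
  using qalg_gen_subset_qfield_gen[of G] qalg_gen.gen[of x G] by auto

lemma qfield_gen_mult:
  assumes "x \<in> qfield_gen G" "y \<in> qfield_gen G" shows "x * y \<in> qfield_gen G"
proof -
  obtain a b c d where *: "x = a / b" "y = c / d"
    and "a \<in> qalg_gen G" "b \<in> qalg_gen G" "c \<in> qalg_gen G" "d \<in> qalg_gen G"
    using assms unfolding qfield_gen_def by blast
  then have "(a * c) / (b * d) \<in> qfield_gen G" by (intro qfield_genI qalg_gen.mult)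
  then show ?thesis by (simp add: *)
qed

lemma qfield_gen_divide:
  assumes "x \<in> qfield_gen G" "y \<in> qfield_gen G" shows "x / y \<in> qfield_gen G"
proof -
  obtain a b c d where *: "x = a / b" "y = c / d"
    and "a \<in> qalg_gen G" "b \<in> qalg_gen G" "c \<in> qalg_gen G" "d \<in> qalg_gen G"
    using assms unfolding qfield_gen_def by blast
  then have "(a * d) / (b * c) \<in> qfield_gen G" by (intro qfield_genI qalg_gen.mult)
  then show ?thesis by (simp add: *)
qed

lemma qfield_gen_add:
  assumes "x \<in> qfield_gen G" "y \<in> qfield_gen G" shows "x + y \<in> qfield_gen G"
proof -
  obtain a b c d where *: "x = a / b" "y = c / d"
    and mem: "a \<in> qalg_gen G" "b \<in> qalg_gen G" "c \<in> qalg_gen G" "d \<in> qalg_gen G"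
    using assms unfolding qfield_gen_def by blast
  show ?thesis
  proof (cases "b = 0 \<or> d = 0")
    case True
    then show ?thesis using assms by (auto simp: *)
  next
    case False
    then have "x + y = (a * d + c * b) / (b * d)" by (simp add: * add_frac_eq)
    moreover have "(a * d + c * b) / (b * d) \<in> qfield_gen G"
      using mem by (intro qfield_genI qalg_gen.mult qalg_gen.add)
    ultimately show ?thesis by simp
  qed
qed

lemma qfield_gen_uminus: "x \<in> qfield_gen G \<Longrightarrow> - x \<in> qfield_gen G"
  using qfield_gen_mult[of "- 1" G x] qalg_gen_subset_qfield_gen[of G] qalg_gen_uminus[of 1 G]
  by auto

lemma qfield_gen_power: "x \<in> qfield_gen G \<Longrightarrow> x ^ n \<in> qfield_gen G"
  by (induction n) (auto intro: qfield_gen_mult)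

lemma qfield_gen_sum: "(\<And>i. i \<in> I \<Longrightarrow> g i \<in> qfield_gen G) \<Longrightarrow> sum g I \<in> qfield_gen G"
  by (induction I rule: infinite_finite_induct) (auto intro: qfield_gen_add)

lemma qfield_gen_prod: "(\<And>i. i \<in> I \<Longrightarrow> g i \<in> qfield_gen G) \<Longrightarrow> prod g I \<in> qfield_gen G"
  by (induction I rule: infinite_finite_induct) (auto intro: qfield_gen_mult)

lemma qalg_gen_subset_qfield_genI:
  assumes "G \<subseteq> qfield_gen G'" shows "qalg_gen G \<subseteq> qfield_gen G'"
proof
  fix x assume "x \<in> qalg_gen G"
  then show "x \<in> qfield_gen G'"
  proof induction
    case (rat q)
    then show ?case using qalg_gen_subset_qfield_gen qalg_gen.rat by blast
  qed (use assms in \<open>auto intro: qfield_gen_add qfield_gen_mult\<close>)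
qed

lemma qfield_gen_poly_mult:
  assumes "\<And>i. coeff p i \<in> qfield_gen G" "\<And>i. coeff q i \<in> qfield_gen G"
  shows "coeff (p * q) i \<in> qfield_gen G"
  unfolding coeff_mult using assms by (intro qfield_gen_sum qfield_gen_mult)

lemma qfield_gen_poly_power:
  assumes "\<And>i. coeff p i \<in> qfield_gen G"
  shows "coeff (p ^ n) i \<in> qfield_gen G"
proof (induction n arbitrary: i)
  case 0
  then show ?case by (simp add: coeff_1)
next
  case (Suc n)
  then show ?case using assms by (simp add: qfield_gen_poly_mult)
qed

section \<open>Transcendental elements\<close>

definition transcendental_over :: "'a::field_char_0 set \<Rightarrow> 'a \<Rightarrow> bool" where
  "transcendental_over R t \<longleftrightarrow> (\<forall>p. (\<forall>i. coeff p i \<in> R) \<longrightarrow> poly p t = 0 \<longrightarrow> p = 0)"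

text \<open>A common denominator is built up by induction, one coefficient at a time.\<close>

lemma qfield_gen_poly_clear_denominators:
  assumes "\<And>i. coeff p i \<in> qfield_gen G"
  shows "\<exists>d. d \<in> qalg_gen G \<and> d \<noteq> 0 \<and> (\<forall>i. coeff (smult d p) i \<in> qalg_gen G)"
  using assms
proof (induction p)
  case 0
  then show ?case by (intro exI[of _ 1]) auto
next
  case (pCons a p)
  have "coeff p i \<in> qfield_gen G" for i
    using pCons.prems[of "Suc i"] by simp
  then obtain d where d: "d \<in> qalg_gen G" "d \<noteq> 0" "\<And>i. d * coeff p i \<in> qalg_gen G"
    using pCons.IH by auto
  have "a \<in> qfield_gen G" using pCons.prems[of 0] by simp
  then obtain u v where uv: "a = u / v" "u \<in> qalg_gen G" "v \<in> qalg_gen G"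
    unfolding qfield_gen_def by blast
  \<comment> \<open>If \<open>v = 0\<close>, then \<open>a = 0\<close> by the convention for
    division, and 1 serves as a nonzero denominator.\<close>
  define w where "w = (if v = 0 then 1 else v)"
  have w: "w \<in> qalg_gen G" "w \<noteq> 0" "w * a \<in> qalg_gen G"
    using uv by (auto simp: w_def)
  have "(w * d) * coeff (pCons a p) i \<in> qalg_gen G" for i
  proof (cases i)
    case 0
    then show ?thesis using qalg_gen.mult[OF d(1) w(3)] by (simp add: ac_simps)
  next
    case (Suc j)
    then show ?thesis using qalg_gen.mult[OF w(1) d(3)[of j]] by (simp add: ac_simps)
  qed
  then have "\<forall>i. coeff (smult (w * d) (pCons a p)) i \<in> qalg_gen G"
    unfolding coeff_smult by blast
  then show ?case using d w by (intro exI[of _ "w * d"]) (auto intro: qalg_gen.mult)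
qed

lemma transcendental_over_qfield_gen:
  assumes "transcendental_over (qalg_gen G) t"
  shows "transcendental_over (qfield_gen G) t"
  unfolding transcendental_over_def
proof (intro allI impI)
  fix p assume p: "\<forall>i. coeff p i \<in> qfield_gen G" "poly p t = 0"
  obtain d where "d \<noteq> 0" "\<forall>i. coeff (smult d p) i \<in> qalg_gen G"
    using qfield_gen_poly_clear_denominators p(1) by blast
  moreover have "poly (smult d p) t = 0" using p(2) by simp
  ultimately have "smult d p = 0"
    using assms unfolding transcendental_over_def by blast
  then show "p = 0" using \<open>d \<noteq> 0\<close> by simp
qed

lemma transcendental_over_nonzero:
  assumes "transcendental_over (qalg_gen G) t" shows "t \<noteq> 0"
proof
  assume "t = 0"
  then have "poly [:0, 1:] t = 0" by simp
  moreover have "\<forall>i. coeff [:0, 1:] i \<in> qalg_gen G"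
    by (auto simp: coeff_pCons split: nat.split)
  ultimately have "[:0, 1:] = (0 :: 'a poly)"
    using assms unfolding transcendental_over_def by blast
  then show False by simp
qed

lemma transcendental_over_notin:
  assumes "transcendental_over (qalg_gen G) t" shows "t \<notin> qalg_gen G"
proof
  assume "t \<in> qalg_gen G"
  then have "\<forall>i. coeff [:- t, 1:] i \<in> qalg_gen G"
    by (auto simp: coeff_pCons qalg_gen_uminus split: nat.split)
  moreover have "poly [:- t, 1:] t = 0" by simp
  ultimately have "[:- t, 1:] = 0"
    using assms unfolding transcendental_over_def by blast
  then show False by simp
qed

text \<open>Made for the exchange relation: the new variable is \<open>m / t\<close> with
  \<open>t\<close> the old variable and \<open>m\<close> a polynomial in the other ones.\<close>

lemma transcendental_over_divide:
  assumes t: "transcendental_over (qalg_gen G) t" and m: "m \<in> qalg_gen G" "m \<noteq> 0"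
  shows "transcendental_over (qalg_gen G) (m / t)"
  unfolding transcendental_over_def
proof (intro allI impI)
  fix p assume p: "\<forall>i. coeff p i \<in> qalg_gen G" "poly p (m / t) = 0"
  have t0: "t \<noteq> 0" using transcendental_over_nonzero t by blast
  define n where "n = degree p"
  \<comment> \<open>The reversed polynomial, with value t^n p(m/t) at \<open>t\<close>. Its
    coefficient at \<open>n - i\<close> is \<open>coeff p i * m ^ i\<close>, so \<open>q = 0\<close>
    gives \<open>p = 0\<close> because \<open>m\<close> is nonzero.\<close>
  define q where "q = (\<Sum>i\<le>n. monom (coeff p i * m ^ i) (n - i))"
  have q_coeff: "coeff q j = (\<Sum>i\<le>n. if n - i = j then coeff p i * m ^ i else 0)" for j
    by (simp add: q_def coeff_sum)
  have "coeff q j \<in> qalg_gen G" for j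
    unfolding q_coeff using p(1) m(1) by (auto intro!: qalg_gen_sum qalg_gen.mult qalg_gen_power)
  moreover have "poly q t = t ^ n * poly p (m / t)"
  proof -
    have "m ^ i * t ^ (n - i) = t ^ n * (m / t) ^ i" if "i \<le> n" for i
      using t0 that by (simp add: power_divide power_diff)
    then show ?thesis
      unfolding q_def poly_altdef[of p] n_def[symmetric] poly_sum poly_monom sum_distrib_left
      by (intro sum.cong) (auto simp: mult.assoc mult.left_commute)
  qed
  ultimately have "q = 0"
    using t p(2) unfolding transcendental_over_def by simp
  show "p = 0"
  proof (rule poly_eqI)
    fix i
    show "coeff p i = coeff 0 i"
    proof (cases "i \<le> n")
      case True
      have "coeff q (n - i) = (\<Sum>j\<le>n. if j = i then coeff p j * m ^ j else 0)"
        unfolding q_coeff using True by (intro sum.cong) auto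
      also have "\<dots> = coeff p i * m ^ i" using True by simp
      finally show ?thesis using \<open>q = 0\<close> m(2) by simp
    next
      case False
      then show ?thesis by (simp add: coeff_eq_0 n_def)
    qed
  qed
qed

text \<open>A homogeneous form of Vieta's formulas: the inner sum is the k-th elementary symmetric
  function of \<open>Y\<close>, so the product depends on \<open>Y\<close> only through these
  functions.\<close>

lemma prod_diff_smult_elementary_symmetric:
  fixes p q :: "'a::field_char_0 poly"
  assumes "finite Y"
  shows "(\<Prod>y\<in>Y. p - smult y q) =
    (\<Sum>k\<le>card Y. smult (\<Sum>X | X \<subseteq> Y \<and> card X = k. \<Prod>X) ((- q) ^ k * p ^ (card Y - k)))"
proof -
  have "(\<Prod>y\<in>Y. p - smult y q) = (\<Prod>y\<in>Y. smult y (- q) + p)"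
    by (intro prod.cong) auto
  also have "\<dots> = (\<Sum>X\<in>Pow Y. (\<Prod>y\<in>X. smult y (- q)) * (\<Prod>y\<in>Y - X. p))"
    using assms by (rule prod_add)
  also have "\<dots> = (\<Sum>X\<in>Pow Y. smult (\<Prod>X) ((- q) ^ card X * p ^ (card Y - card X)))"
  proof (rule sum.cong[OF HOL.refl])
    fix X assume "X \<in> Pow Y"
    then have "finite X" "X \<subseteq> Y" using assms by (auto intro: finite_subset)
    have "(\<Prod>y\<in>X. smult y (- q)) = smult (\<Prod>X) ((- q) ^ card X)"
      using \<open>finite X\<close> by (induction X) (auto simp: ac_simps)
    moreover have "(\<Prod>y\<in>Y - X. p) = p ^ (card Y - card X)"
      using \<open>finite X\<close> \<open>X \<subseteq> Y\<close> by (simp add: card_Diff_subset)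
    ultimately show "(\<Prod>y\<in>X. smult y (- q)) * (\<Prod>y\<in>Y - X. p) =
        smult (\<Prod>X) ((- q) ^ card X * p ^ (card Y - card X))"
      by simp
  qed
  also have "\<dots> = (\<Sum>k\<le>card Y. \<Sum>X\<in>{X \<in> Pow Y. card X = k}.
      smult (\<Prod>X) ((- q) ^ card X * p ^ (card Y - card X)))"
    using assms by (intro sum.group[symmetric]) (auto intro: card_mono)
  also have "\<dots> = (\<Sum>k\<le>card Y. smult (\<Sum>X | X \<subseteq> Y \<and> card X = k. \<Prod>X) ((- q) ^ k * p ^ (card Y - k)))"
    by (intro sum.cong HOL.refl) (auto simp: smult_sum intro!: sum.cong)
  finally show ?thesis .
qed

text \<open>A rational function field in one variable contains no new algebraic elements: writing
\<open>z = p(t) / q(t)\<close>, the polynomial \<open>\<Prod>(p - y q)\<close> over the conjugates \<open>y\<close> of \<open>z\<close> has coefficients in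
the base field and vanishes at \<open>t\<close>, so one of its factors is zero.\<close>
lemma qfield_gen_insert_conjugates:
  assumes t: "transcendental_over (qalg_gen G) t"
    and z: "z \<in> qfield_gen (insert t G)"
    and Y: "finite Y" "z \<in> Y"
    and sym: "\<And>k. (\<Sum>X | X \<subseteq> Y \<and> card X = k. \<Prod>X) \<in> qfield_gen G"
  shows "z \<in> qfield_gen G"
proof -
  obtain a b where ab: "z = a / b" "a \<in> qalg_gen (insert t G)" "b \<in> qalg_gen (insert t G)"
    using z unfolding qfield_gen_def by blast
  obtain p where p: "\<And>i. coeff p i \<in> qalg_gen G" "a = poly p t"
    using qalg_gen_insert_poly ab(2) by blast
  obtain q where q: "\<And>i. coeff q i \<in> qalg_gen G" "b = poly q t"
    using qalg_gen_insert_poly ab(3) by blast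
  show ?thesis
  proof (cases "b = 0")
    case True
    then show ?thesis by (simp add: ab)
  next
    case False
    have p': "coeff p i \<in> qfield_gen G" and q': "coeff (- q) i \<in> qfield_gen G" for i
      using p(1)[of i] q(1)[of i] qalg_gen_subset_qfield_gen[of G] by (auto intro: qfield_gen_uminus)
    let ?F = "\<Prod>y\<in>Y. p - smult y q"
    have "coeff ?F i \<in> qfield_gen G" for i
      unfolding prod_diff_smult_elementary_symmetric[OF Y(1)] coeff_sum coeff_smult
      by (intro qfield_gen_sum qfield_gen_mult sym qfield_gen_poly_mult qfield_gen_poly_power p' q')
    moreover have "poly ?F t = 0"
      using Y ab False p(2) q(2) by (auto simp: poly_prod intro!: bexI[of _ z])
    ultimately have "?F = 0"
      using transcendental_over_qfield_gen[OF t] unfolding transcendental_over_def by blast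
    then obtain y where y: "p = smult y q" using Y(1) by (auto simp: prod_zero_iff)
    \<comment> \<open>The vanishing factor says \<open>p = smult y q\<close>. Evaluation at
      \<open>t\<close> gives \<open>y = z\<close>, and comparing one nonzero coefficient of
      \<open>q\<close> writes \<open>z\<close> as a quotient of elements of the base ring.\<close>
    have "q \<noteq> 0" using False q(2) by auto
    then obtain i where i: "coeff q i \<noteq> 0" by (metis leading_coeff_neq_0)
    have "z = y" using ab(1) p(2) q(2) y False by simp
    also have "y = coeff p i / coeff q i" using i y by simp
    also have "\<dots> \<in> qfield_gen G" using p(1) q(1) by (rule qfield_genI)
    finally show ?thesis .
  qed
qed

section \<open>Algebraic independence\<close>

text \<open>The generated algebra in the normal form that \<open>alg_indep\<close> speaks about.
  Requiring exponents to vanish off \<open>I\<close> prevents one monomial from having several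
  exponent functions.\<close>

definition polynomial_expressions :: "'i set \<Rightarrow> ('i \<Rightarrow> 'a::field_char_0) \<Rightarrow> 'a set" where
  "polynomial_expressions I x =
     {(\<Sum>e\<in>T. of_rat (c e) * (\<Prod>i\<in>I. x i ^ e i)) | T c.
        finite T \<and> (\<forall>e\<in>T. \<forall>i. i \<notin> I \<longrightarrow> e i = 0)}"

lemma polynomial_expressions_monomial:
  assumes "\<And>i. i \<notin> I \<Longrightarrow> e i = 0"
  shows "of_rat r * (\<Prod>i\<in>I. x i ^ e i) \<in> polynomial_expressions I x"
  unfolding polynomial_expressions_def
  by (rule CollectI, rule exI[of _ "{e}"], rule exI[of _ "\<lambda>_. r"]) (use assms in auto)

lemma polynomial_expressions_add:
  assumes "y \<in> polynomial_expressions I x" "z \<in> polynomial_expressions I x"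
  shows "y + z \<in> polynomial_expressions I x"
proof -
  let ?m = "\<lambda>e. \<Prod>i\<in>I. x i ^ e i"
  obtain T c where T: "finite T" "\<forall>e\<in>T. \<forall>i. i \<notin> I \<longrightarrow> e i = 0"
    "y = (\<Sum>e\<in>T. of_rat (c e) * ?m e)"
    using assms(1) unfolding polynomial_expressions_def by blast
  obtain T' c' where T': "finite T'" "\<forall>e\<in>T'. \<forall>i. i \<notin> I \<longrightarrow> e i = 0"
    "z = (\<Sum>e\<in>T'. of_rat (c' e) * ?m e)"
    using assms(2) unfolding polynomial_expressions_def by blast
  define d where "d = (\<lambda>e. if e \<in> T then c e else 0)"
  define d' where "d' = (\<lambda>e. if e \<in> T' then c' e else 0)"
  have "y = (\<Sum>e\<in>T \<union> T'. of_rat (d e) * ?m e)"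
    unfolding T(3) using T(1) T'(1) by (intro sum.mono_neutral_cong_left) (auto simp: d_def)
  moreover have "z = (\<Sum>e\<in>T \<union> T'. of_rat (d' e) * ?m e)"
    unfolding T'(3) using T(1) T'(1) by (intro sum.mono_neutral_cong_left) (auto simp: d'_def)
  ultimately have "y + z = (\<Sum>e\<in>T \<union> T'. of_rat (d e + d' e) * ?m e)"
    by (simp add: sum.distrib of_rat_add distrib_right)
  then show ?thesis
    unfolding polynomial_expressions_def using T(1,2) T'(1,2)
    by (intro CollectI exI[of _ "T \<union> T'"] exI[of _ "\<lambda>e. d e + d' e"]) auto
qed

lemma polynomial_expressions_0: "0 \<in> polynomial_expressions I x"
  unfolding polynomial_expressions_def by (rule CollectI, rule exI[of _ "{}"]) auto

lemma polynomial_expressions_sum: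
  "(\<And>j. j \<in> J \<Longrightarrow> g j \<in> polynomial_expressions I x) \<Longrightarrow> sum g J \<in> polynomial_expressions I x"
  by (induction J rule: infinite_finite_induct)
     (auto intro: polynomial_expressions_add polynomial_expressions_0)

lemma polynomial_expressions_mult:
  assumes "y \<in> polynomial_expressions I x" "z \<in> polynomial_expressions I x"
  shows "y * z \<in> polynomial_expressions I x"
proof -
  let ?m = "\<lambda>e. \<Prod>i\<in>I. x i ^ e i"
  obtain T c where T: "\<forall>e\<in>T. \<forall>i. i \<notin> I \<longrightarrow> e i = 0" "y = (\<Sum>e\<in>T. of_rat (c e) * ?m e)"
    using assms(1) unfolding polynomial_expressions_def by blast
  obtain T' c' where T': "\<forall>e\<in>T'. \<forall>i. i \<notin> I \<longrightarrow> e i = 0" "z = (\<Sum>e\<in>T'. of_rat (c' e) * ?m e)"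
    using assms(2) unfolding polynomial_expressions_def by blast
  have "y * z = (\<Sum>e\<in>T. \<Sum>e'\<in>T'. of_rat (c e * c' e') * (\<Prod>i\<in>I. x i ^ (e i + e' i)))"
    unfolding T(2) T'(2) sum_product
    by (simp add: of_rat_mult power_add prod.distrib ac_simps)
  moreover have "of_rat (c e * c' e') * (\<Prod>i\<in>I. x i ^ (e i + e' i)) \<in> polynomial_expressions I x"
    if "e \<in> T" "e' \<in> T'" for e e'
    using that T(1) T'(1) by (intro polynomial_expressions_monomial) auto
  ultimately show ?thesis by (auto intro!: polynomial_expressions_sum)
qed

lemma qalg_gen_subset_polynomial_expressions:
  assumes "finite I"
  shows "qalg_gen (x ` I) \<subseteq> polynomial_expressions I x"
proof
  fix z assume "z \<in> qalg_gen (x ` I)"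
  then show "z \<in> polynomial_expressions I x"
  proof induction
    case (gen y)
    then obtain j where j: "j \<in> I" "y = x j" by blast
    have "(\<Prod>i\<in>I. x i ^ (if i = j then 1 else 0)) = (\<Prod>i\<in>I. if i = j then x i else 1)"
      by (intro prod.cong) auto
    also have "\<dots> = y" using j assms by simp
    finally show ?case
      using polynomial_expressions_monomial[of I "\<lambda>i. if i = j then 1 else 0" 1 x] j(1) by fastforce
  next
    case (rat q)
    then show ?case using polynomial_expressions_monomial[of I "\<lambda>_. 0" q x] by simp
  qed (auto intro: polynomial_expressions_add polynomial_expressions_mult)
qed

section \<open>Adjoining and removing one independent variable\<close>

lemma alg_indepD:
  assumes "alg_indep I x" "finite T" "\<And>e i. e \<in> T \<Longrightarrow> i \<notin> I \<Longrightarrow> e i = 0"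
    "(\<Sum>e\<in>T. of_rat (c e) * (\<Prod>i\<in>I. x i ^ e i)) = 0" "e \<in> T"
  shows "c e = 0"
  using assms unfolding alg_indep_def by blast

text \<open>Expanding the coefficients of \<open>p\<close> into monomials over \<open>J\<close>
  turns \<open>poly p (x k) = 0\<close> into a linear relation between monomials over
  \<open>insert k J\<close>, all of whose coefficients must vanish.\<close>

lemma alg_indep_insertD_transcendental:
  assumes ind: "alg_indep (insert k J) x" and J: "finite J" "k \<notin> J"
  shows "transcendental_over (qalg_gen (x ` J)) (x k)"
  unfolding transcendental_over_def
proof (intro allI impI)
  fix p assume p: "\<forall>i. coeff p i \<in> qalg_gen (x ` J)" "poly p (x k) = 0"
  let ?m = "\<lambda>I e. \<Prod>i\<in>I. x i ^ e i"
  have "\<forall>n. \<exists>T c. finite T \<and> (\<forall>e\<in>T. \<forall>i. i \<notin> J \<longrightarrow> e i = 0) \<and>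
      coeff p n = (\<Sum>e\<in>T. of_rat (c e) * ?m J e)"
  proof
    fix n
    have "coeff p n \<in> polynomial_expressions J x"
      using p(1) qalg_gen_subset_polynomial_expressions[OF J(1), of x] by blast
    then show "\<exists>T c. finite T \<and> (\<forall>e\<in>T. \<forall>i. i \<notin> J \<longrightarrow> e i = 0) \<and>
        coeff p n = (\<Sum>e\<in>T. of_rat (c e) * ?m J e)"
      unfolding polynomial_expressions_def by blast
  qed
  then obtain T c where Tc: "\<forall>n. finite (T n) \<and> (\<forall>e\<in>T n. \<forall>i. i \<notin> J \<longrightarrow> e i = 0) \<and>
      coeff p n = (\<Sum>e\<in>T n. of_rat (c n e) * ?m J e)"
    unfolding choice_iff by (elim exE)
  then have T: "\<And>n. finite (T n)" "\<And>n e i. e \<in> T n \<Longrightarrow> i \<notin> J \<Longrightarrow> e i = 0" by simp_all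
  have c: "coeff p n = (\<Sum>e\<in>T n. of_rat (c n e) * ?m J e)" for n
    using spec[OF Tc, of n] by (elim conjE)
  \<comment> \<open>A pair (n, e) stands for the term of degree n in \<open>x k\<close> with
    exponents e in the other variables. The map \<open>h\<close> merges it into one exponent
    function, and \<open>d\<close> recovers its coefficient.\<close>
  define U where "U = (SIGMA n:{..degree p}. T n)"
  define h where "h = (\<lambda>(n, e). e(k := n) :: _ \<Rightarrow> nat)"
  define d where "d = (\<lambda>e. c (e k) (e(k := 0)))"
  have restore: "e(k := 0) = e" if "e \<in> T n" for n e
    using T(2)[OF that J(2)] by auto
  have h_simps: "h (n, e) k = n" "(h (n, e))(k := 0) = e" if "e \<in> T n" for n e
    using restore[OF that] by (auto simp: h_def)
  have inj: "inj_on h U"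
    by (rule inj_on_inverseI[where g = "\<lambda>e. (e k, e(k := 0))"]) (auto simp: U_def h_simps)
  have m_h: "?m (insert k J) (h (n, e)) = ?m J e * x k ^ n" if "e \<in> T n" for n e
  proof -
    have "?m J (h (n, e)) = ?m J e" using J(2) by (intro prod.cong) (auto simp: h_def)
    then show ?thesis using J by (simp add: h_simps[OF that] mult.commute)
  qed
  have "(\<Sum>e\<in>h ` U. of_rat (d e) * ?m (insert k J) e) =
      (\<Sum>u\<in>U. of_rat (d (h u)) * ?m (insert k J) (h u))"
    using sum.reindex[OF inj] by (simp add: comp_def)
  also have "\<dots> = (\<Sum>(n, e)\<in>U. of_rat (c n e) * ?m J e * x k ^ n)"
    by (rule sum.cong) (auto simp: U_def d_def h_simps m_h mult.assoc)
  also have "\<dots> = (\<Sum>n\<le>degree p. \<Sum>e\<in>T n. of_rat (c n e) * ?m J e * x k ^ n)"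
    unfolding U_def using T(1) by (subst sum.Sigma) auto
  also have "\<dots> = poly p (x k)"
    unfolding poly_altdef c sum_distrib_right by (rule HOL.refl)
  finally have "(\<Sum>e\<in>h ` U. of_rat (d e) * ?m (insert k J) e) = 0" using p(2) by simp
  moreover have "finite (h ` U)" using T(1) by (auto simp: U_def)
  moreover have "e i = 0" if "e \<in> h ` U" "i \<notin> insert k J" for e i
    using that T(2) by (auto simp: U_def h_def)
  ultimately have d0: "d e = 0" if "e \<in> h ` U" for e
    using alg_indepD[OF ind] that by blast
  have "c n e = 0" if "n \<le> degree p" "e \<in> T n" for n e
  proof -
    have "h (n, e) \<in> h ` U" using that by (auto simp: U_def)
    from d0[OF this] show ?thesis using that by (simp add: d_def h_simps)
  qed
  then have "coeff p n = 0" if "n \<le> degree p" for n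
    using that by (simp add: c)
  then show "p = 0" by (metis leading_coeff_0_iff order_refl)
qed

lemma alg_indep_insertD:
  assumes ind: "alg_indep (insert k J) x" and J: "finite J" "k \<notin> J"
  shows "alg_indep J x"
  unfolding alg_indep_def
proof (intro allI impI)
  fix T :: "('a \<Rightarrow> nat) set" and c :: "('a \<Rightarrow> nat) \<Rightarrow> rat"
  assume T: "finite T" "\<forall>e\<in>T. \<forall>i. i \<notin> J \<longrightarrow> e i = 0"
    and s: "(\<Sum>e\<in>T. of_rat (c e) * (\<Prod>i\<in>J. x i ^ e i)) = 0"
  have "(\<Sum>e\<in>T. of_rat (c e) * (\<Prod>i\<in>insert k J. x i ^ e i)) =
      (\<Sum>e\<in>T. of_rat (c e) * (\<Prod>i\<in>J. x i ^ e i))"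
    using T J by (intro sum.cong) auto
  then have "(\<Sum>e\<in>T. of_rat (c e) * (\<Prod>i\<in>insert k J. x i ^ e i)) = 0" using s by simp
  then show "\<forall>e\<in>T. c e = 0"
    using alg_indepD[OF ind T(1), of c] T(2) by simp
qed

lemma alg_indep_cong:
  assumes "\<And>i. i \<in> I \<Longrightarrow> x i = y i"
  shows "alg_indep I x = alg_indep I y"
proof -
  have "(\<Prod>i\<in>I. x i ^ e i) = (\<Prod>i\<in>I. y i ^ e i)" for e :: "_ \<Rightarrow> nat"
    using assms by (intro prod.cong) auto
  then show ?thesis unfolding alg_indep_def by simp
qed

text \<open>A relation is sorted by powers of \<open>x k\<close>. Transcendence kills the
  coefficient of each power, and independence over \<open>J\<close> then kills each term in that
  coefficient.\<close>

lemma alg_indep_insertI: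
  assumes ind: "alg_indep J x" and J: "finite J" "k \<notin> J"
    and tr: "transcendental_over (qalg_gen (x ` J)) (x k)"
  shows "alg_indep (insert k J) x"
  unfolding alg_indep_def
proof (intro allI impI ballI)
  fix T :: "('a \<Rightarrow> nat) set" and c :: "('a \<Rightarrow> nat) \<Rightarrow> rat" and e0
  let ?m = "\<lambda>e. \<Prod>i\<in>J. x i ^ e i"
  assume T: "finite T" "\<forall>e\<in>T. \<forall>i. i \<notin> insert k J \<longrightarrow> e i = 0"
    and s: "(\<Sum>e\<in>T. of_rat (c e) * (\<Prod>i\<in>insert k J. x i ^ e i)) = 0"
    and e0: "e0 \<in> T"
  define p where "p = (\<Sum>e\<in>T. monom (of_rat (c e) * ?m e) (e k))"
  have p_coeff: "coeff p n = (\<Sum>e\<in>T. if e k = n then of_rat (c e) * ?m e else 0)" for n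
    by (simp add: p_def coeff_sum)
  have "?m e \<in> qalg_gen (x ` J)" for e
    by (intro qalg_gen_prod qalg_gen_power qalg_gen.gen imageI)
  then have "coeff p n \<in> qalg_gen (x ` J)" for n
    unfolding p_coeff by (intro qalg_gen_sum) (simp add: qalg_gen.mult qalg_gen.rat)
  moreover have "poly p (x k) = 0"
    using s J by (simp add: p_def poly_sum poly_monom ac_simps)
  ultimately have "p = 0" using tr unfolding transcendental_over_def by blast
  \<comment> \<open>Only the terms with the same power of \<open>x k\<close> as \<open>e0\<close>
    are kept. Among these, erasing the exponent at \<open>k\<close> is injective, so no two terms
    collapse.\<close>
  define T' where "T' = {e \<in> T. e k = e0 k}"
  define h where "h = (\<lambda>e. e(k := 0) :: 'a \<Rightarrow> nat)"
  have inj: "inj_on h T'"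
    by (rule inj_on_inverseI[where g = "\<lambda>e. e(k := e0 k)"]) (auto simp: T'_def h_def)
  define d where "d = (\<lambda>e. c (e(k := e0 k)))"
  have m_h: "?m (h e) = ?m e" for e
    using J(2) by (intro prod.cong) (auto simp: h_def)
  have d_h: "d (h e) = c e" if "e \<in> T'" for e
    using that fun_upd_triv[of e k] by (simp add: d_def h_def T'_def)
  have "(\<Sum>e\<in>h ` T'. of_rat (d e) * ?m e) = (\<Sum>e\<in>T'. of_rat (c e) * ?m e)"
    by (simp add: sum.reindex[OF inj] d_h m_h)
  also have "\<dots> = coeff p (e0 k)"
    unfolding p_coeff T'_def by (rule sum.inter_filter[OF T(1)])
  finally have "(\<Sum>e\<in>h ` T'. of_rat (d e) * ?m e) = 0" using \<open>p = 0\<close> by simp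
  moreover have "finite (h ` T')" using T(1) by (simp add: T'_def)
  moreover have "e i = 0" if "e \<in> h ` T'" "i \<notin> J" for e i
    using that T(2) by (auto simp: T'_def h_def)
  moreover have "e0 \<in> T'" using e0 by (simp add: T'_def)
  ultimately have "d (h e0) = 0"
    using alg_indepD[OF ind] by blast
  then show "c e0 = 0" using d_h \<open>e0 \<in> T'\<close> by simp
qed

text \<open>Used to recover a column of an exchange matrix, up to sign, from its exchange
  binomial.\<close>

lemma alg_indep_monomial_pairs_eq:
  fixes x :: "'i \<Rightarrow> 'a::field_char_0" and a b c d :: "'i \<Rightarrow> nat"
  assumes ind: "alg_indep I x"
    and supp: "\<And>i. i \<notin> I \<Longrightarrow> a i = 0" "\<And>i. i \<notin> I \<Longrightarrow> b i = 0"
      "\<And>i. i \<notin> I \<Longrightarrow> c i = 0" "\<And>i. i \<notin> I \<Longrightarrow> d i = 0"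
    and eq: "(\<Prod>i\<in>I. x i ^ a i) + (\<Prod>i\<in>I. x i ^ b i) = (\<Prod>i\<in>I. x i ^ c i) + (\<Prod>i\<in>I. x i ^ d i)"
  shows "a = c \<and> b = d \<or> a = d \<and> b = c"
proof -
  let ?m = "\<lambda>e. \<Prod>i\<in>I. x i ^ e i"
  let ?T = "{a, b, c, d}"
  define \<delta> :: "('i \<Rightarrow> nat) \<Rightarrow> ('i \<Rightarrow> nat) \<Rightarrow> rat" where "\<delta> = (\<lambda>u e. if e = u then 1 else 0)"
  \<comment> \<open>The signed multiplicity of \<open>e\<close> among the four exponents, which
    stays correct when some of them coincide. Its vanishing at \<open>a\<close> means that
    \<open>a\<close> is cancelled by \<open>c\<close> or \<open>d\<close>.\<close>
  define w where "w = (\<lambda>e. \<delta> a e + \<delta> b e - \<delta> c e - \<delta> d e)"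
  have \<delta>: "(\<Sum>e\<in>?T. of_rat (\<delta> u e) * ?m e) = ?m u" if "u \<in> ?T" for u
  proof -
    have "(\<Sum>e\<in>?T. of_rat (\<delta> u e) * ?m e) = (\<Sum>e\<in>?T. if e = u then ?m e else 0)"
      by (intro sum.cong) (auto simp: \<delta>_def)
    also have "\<dots> = ?m u" using that by (subst sum.delta) auto
    finally show ?thesis .
  qed
  have "(\<Sum>e\<in>?T. of_rat (w e) * ?m e) = ?m a + ?m b - ?m c - ?m d"
    unfolding w_def of_rat_add of_rat_diff distrib_right left_diff_distrib sum.distrib sum_subtractf
    using \<delta>[of a] \<delta>[of b] \<delta>[of c] \<delta>[of d] by simp
  also have "\<dots> = 0" using eq by simp
  finally have "(\<Sum>e\<in>?T. of_rat (w e) * ?m e) = 0" .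
  moreover have "e i = 0" if "e \<in> ?T" "i \<notin> I" for e i using that supp by auto
  ultimately have "w e = 0" if "e \<in> ?T" for e
    using alg_indepD[OF ind, of ?T w] that by blast
  then have "w a = 0" "w b = 0" by auto
  have "a = c \<or> a = d"
    using \<open>w a = 0\<close> by (cases "a = b") (auto simp: w_def \<delta>_def split: if_splits)
  then show ?thesis
    using \<open>w b = 0\<close> by (cases "b = c"; cases "b = d") (auto simp: w_def \<delta>_def)
qed

lemma alg_indep_monomial_sum_nonzero:
  fixes x :: "'i \<Rightarrow> 'a::field_char_0" and a b :: "'i \<Rightarrow> nat"
  assumes ind: "alg_indep I x" and supp: "\<And>i. i \<notin> I \<Longrightarrow> a i = 0" "\<And>i. i \<notin> I \<Longrightarrow> b i = 0"
  shows "(\<Prod>i\<in>I. x i ^ a i) + (\<Prod>i\<in>I. x i ^ b i) \<noteq> 0"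
proof
  let ?m = "\<lambda>e. \<Prod>i\<in>I. x i ^ e i"
  assume eq: "?m a + ?m b = 0"
  \<comment> \<open>For \<open>a = b\<close> the set \<open>{a, b}\<close> has one element, which
    must then count twice.\<close>
  define c :: "('i \<Rightarrow> nat) \<Rightarrow> rat" where "c = (\<lambda>e. if a = b then 2 else 1)"
  have "(\<Sum>e\<in>{a, b}. of_rat (c e) * ?m e) = ?m a + ?m b"
    by (cases "a = b") (auto simp: c_def)
  then have "(\<Sum>e\<in>{a, b}. of_rat (c e) * ?m e) = 0" using eq by simp
  moreover have "e i = 0" if "e \<in> {a, b}" "i \<notin> I" for e i using that supp by auto
  ultimately have "c a = 0"
    using alg_indepD[OF ind, of "{a, b}" c a] by blast
  then show False by (simp add: c_def split: if_splits)
qed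

section \<open>Mutations\<close>

lemma sex_mutate [simp]: "sex (mutate k S) = sex S"
  and sfr_mutate [simp]: "sfr (mutate k S) = sfr S"
  and sidx_mutate [simp]: "sidx (mutate k S) = sidx S"
  and svar_mutate: "svar (mutate k S) = (svar S)(k := mut_var k S)"
  and smat_mutate: "smat (mutate k S) = mut_mat k (smat S)"
  by (auto simp: mutate_def sidx_def)

text \<open>The symmetrizing factors are positive, so they drop out when signs are taken.\<close>

lemma skew_symmetrizable_sgn:
  assumes "skew_symmetrizable E b" "i \<in> E" "j \<in> E"
  shows "sgn (b i j) = - sgn (b j i)"
proof -
  obtain d :: "_ \<Rightarrow> int" where d: "\<forall>i\<in>E. d i > 0" "\<forall>i\<in>E. \<forall>j\<in>E. d i * b i j = - (d j * b j i)"
    using assms(1) unfolding skew_symmetrizable_def by blast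
  have "d i * b i j = - (d j * b j i)" using d(2) assms(2,3) by blast
  then have "sgn (d i * b i j) = - sgn (d j * b j i)" by (simp only: idom_abs_sgn_class.sgn_minus)
  then show ?thesis using d(1) assms(2,3) by (simp add: sgn_mult)
qed

text \<open>The same factors \<open>d\<close> symmetrize the mutated matrix.\<close>

lemma skew_symmetrizable_mut_mat:
  assumes skew: "skew_symmetrizable E b" and k: "k \<in> E"
  shows "skew_symmetrizable E (mut_mat k b)"
proof -
  obtain d :: "_ \<Rightarrow> int" where d: "\<And>i. i \<in> E \<Longrightarrow> d i > 0"
    "\<And>i j. i \<in> E \<Longrightarrow> j \<in> E \<Longrightarrow> d i * b i j = - (d j * b j i)"
    using skew unfolding skew_symmetrizable_def by blast
  have "d i * mut_mat k b i j = - (d j * mut_mat k b j i)" if ij: "i \<in> E" "j \<in> E" for i j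
  proof (cases "i = k \<or> j = k")
    case True
    then show ?thesis using d(2)[OF ij] by (auto simp: mut_mat_def)
  next
    case False
    \<comment> \<open>Both sides equal \<open>- (d k * b k i * b k j)\<close>. Hence the correction
      terms at (i, j) and (j, i) vanish together, and otherwise they carry opposite signs.\<close>
    have P: "d i * (b i k * b k j) = d j * (b j k * b k i)"
      using d(2)[OF ij(1) k] d(2)[OF ij(2) k] by algebra
    have "d i * (sgn (b i k) * max (b i k * b k j) 0) = - (d j * (sgn (b j k) * max (b j k * b k i) 0))"
    proof (cases "b i k * b k j > 0")
      case True
      then have "d j * (b j k * b k i) > 0" using P d(1)[OF ij(1)] by (metis mult_pos_pos)
      then have pos: "b j k * b k i > 0" using d(1)[OF ij(2)] by (simp add: zero_less_mult_iff)
      have "sgn (b i k) = sgn (b k j)" using True by (auto simp: zero_less_mult_iff)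
      then have "sgn (b i k) = - sgn (b j k)"
        using skew_symmetrizable_sgn[OF skew k ij(2)] by simp
      then show ?thesis using True pos P by (simp add: max_def algebra_simps)
    next
      case F: False
      then have "d j * (b j k * b k i) \<le> 0"
        using P d(1)[OF ij(1)] by (metis linorder_not_less mult_nonneg_nonpos order_less_imp_le)
      then have "b j k * b k i \<le> 0" using d(1)[OF ij(2)] by (simp add: mult_le_0_iff)
      then show ?thesis using F by (simp add: max_def)
    qed
    then show ?thesis using False d(2)[OF ij] by (simp add: mut_mat_def distrib_left)
  qed
  then show ?thesis using d(1) unfolding skew_symmetrizable_def by blast
qed

text \<open>Away from row and column \<open>k\<close>, the second mutation sees the same product
  \<open>b i k * b k j\<close> but the opposite sign of \<open>b i k\<close>, so it subtracts what
  the first one added.\<close>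

lemma mut_mat_mut_mat: "mut_mat k (mut_mat k b) = b"
  by (intro ext) (auto simp: mut_mat_def sgn_minus)

lemma alg_indep_inj_on:
  assumes "alg_indep I x" "finite I"
  shows "inj_on x I"
proof (rule inj_onI, rule ccontr)
  fix i j assume ij: "i \<in> I" "j \<in> I" "x i = x j" "i \<noteq> j"
  have "transcendental_over (qalg_gen (x ` (I - {i}))) (x i)"
    using assms ij by (intro alg_indep_insertD_transcendental) (auto simp: insert_absorb)
  moreover have "x i \<in> qalg_gen (x ` (I - {i}))"
    using ij by (auto intro: qalg_gen.gen)
  ultimately show False using transcendental_over_notin by blast
qed

text \<open>The binomial on the right of the exchange relation. It is split off from
  \<open>mut_var\<close> because, at an exchange index of a seed, it does not involve the variable
  being replaced and is unchanged by the mutation.\<close>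

definition exchange_sum :: "'i \<Rightarrow> ('i, 'a::field) seed \<Rightarrow> 'a" where
  "exchange_sum k S = (\<Prod>i\<in>sidx S. svar S i ^ nat (smat S i k))
      + (\<Prod>i\<in>sidx S. svar S i ^ nat (- smat S i k))"

lemma mut_var_eq: "mut_var k S = exchange_sum k S / svar S k"
  by (simp add: mut_var_def exchange_sum_def)

section \<open>Exchange relations and mutations of a single seed\<close>

context
  fixes S :: "('i, 'a::field_char_0) seed"
  assumes S: "is_seed S"
begin

lemma finite_sidx: "finite (sidx S)"
  using S by (simp add: is_seed_def sidx_def)

lemma seed_transcendental:
  assumes "k \<in> sidx S"
  shows "transcendental_over (qalg_gen (svar S ` (sidx S - {k}))) (svar S k)"
  using S assms finite_sidx
  by (intro alg_indep_insertD_transcendental) (auto simp: insert_absorb is_seed_def)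

lemma svar_nonzero: "k \<in> sidx S \<Longrightarrow> svar S k \<noteq> 0"
  using seed_transcendental transcendental_over_nonzero by blast

lemma smat_diag: "k \<in> sex S \<Longrightarrow> smat S k k = 0"
  using S skew_symmetrizable_sgn[of "sex S" "smat S" k k] by (simp add: is_seed_def sgn_eq_0_iff)

text \<open>The diagonal entry at \<open>k\<close> is zero, so variable \<open>k\<close> enters both
  monomials with exponent 0.\<close>

lemma exchange_sum_in_qalg_gen:
  assumes k: "k \<in> sex S"
  shows "exchange_sum k S \<in> qalg_gen (svar S ` (sidx S - {k}))"
proof -
  have "svar S i ^ nat (smat S i k) \<in> qalg_gen (svar S ` (sidx S - {k}))"
    "svar S i ^ nat (- smat S i k) \<in> qalg_gen (svar S ` (sidx S - {k}))" if "i \<in> sidx S" for i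
    using that smat_diag[OF k] by (cases "i = k"; force intro: qalg_gen_power qalg_gen.gen)+
  then show ?thesis
    unfolding exchange_sum_def by (intro qalg_gen.add qalg_gen_prod)
qed

lemma exchange_sum_nonzero: "exchange_sum k S \<noteq> 0"
proof -
  define a where "a = (\<lambda>i. if i \<in> sidx S then nat (smat S i k) else 0)"
  define b where "b = (\<lambda>i. if i \<in> sidx S then nat (- smat S i k) else 0)"
  have "exchange_sum k S = (\<Prod>i\<in>sidx S. svar S i ^ a i) + (\<Prod>i\<in>sidx S. svar S i ^ b i)"
    unfolding exchange_sum_def by (simp add: a_def b_def)
  also have "\<dots> \<noteq> 0"
    using S by (intro alg_indep_monomial_sum_nonzero) (auto simp: is_seed_def a_def b_def)
  finally show ?thesis .
qed

text \<open>The remaining variables stay independent, and the new one is a nonzero polynomial in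
  them divided by the old one, hence transcendental over them.\<close>

lemma is_seed_mutate:
  assumes k: "k \<in> sex S"
  shows "is_seed (mutate k S)"
proof -
  have k': "k \<in> sidx S" using k by (simp add: sidx_def)
  let ?J = "sidx S - {k}" and ?y = "svar (mutate k S)"
  have I: "insert k ?J = sidx S" using k' by blast
  have y_J: "?y i = svar S i" if "i \<in> ?J" for i
    using that by (simp add: svar_mutate)
  have img: "?y ` ?J = svar S ` ?J" using y_J by (intro image_cong) auto
  have "alg_indep ?J (svar S)"
  proof (rule alg_indep_insertD)
    show "alg_indep (insert k ?J) (svar S)" using S by (simp only: I is_seed_def)
  qed (use finite_sidx in auto)
  moreover have "alg_indep ?J ?y = alg_indep ?J (svar S)" by (rule alg_indep_cong) (rule y_J)
  ultimately have "alg_indep ?J ?y" by simp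
  moreover have "transcendental_over (qalg_gen (svar S ` ?J)) (exchange_sum k S / svar S k)"
    by (intro transcendental_over_divide seed_transcendental k'
        exchange_sum_in_qalg_gen k exchange_sum_nonzero)
  then have "transcendental_over (qalg_gen (?y ` ?J)) (?y k)"
    unfolding img by (simp add: svar_mutate mut_var_eq)
  ultimately have "alg_indep (insert k ?J) ?y"
    using finite_sidx alg_indep_insertI[of ?J ?y k] by blast
  then have ind: "alg_indep (sidx S) ?y" by (simp only: I)
  show ?thesis
    unfolding is_seed_def sex_mutate sfr_mutate sidx_mutate
    using S k ind alg_indep_inj_on[OF ind finite_sidx] skew_symmetrizable_mut_mat[of "sex S" "smat S" k]
    by (simp add: is_seed_def smat_mutate)
qed

lemma mutate_mutate:
  assumes k: "k \<in> sex S"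
  shows "mutate k (mutate k S) = S"
proof -
  have k': "k \<in> sidx S" using k by (simp add: sidx_def)
  \<comment> \<open>Negating column \<open>k\<close> swaps the two monomials of the binomial. At
    \<open>i = k\<close> the variable has changed, but its exponent is 0.\<close>
  have pow: "svar (mutate k S) i ^ nat (smat (mutate k S) i k) = svar S i ^ nat (- smat S i k)"
    "svar (mutate k S) i ^ nat (- smat (mutate k S) i k) = svar S i ^ nat (smat S i k)" for i
    using smat_diag[OF k] by (auto simp: svar_mutate smat_mutate mut_mat_def)
  have "exchange_sum k (mutate k S) = exchange_sum k S"
    unfolding exchange_sum_def sidx_mutate pow by (rule add.commute)
  then have "mut_var k (mutate k S) = svar S k"
    using svar_nonzero[OF k'] exchange_sum_nonzero[of k] by (simp add: mut_var_eq svar_mutate)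
  then have "svar (mutate k (mutate k S)) = svar S"
    by (simp add: svar_mutate)
  then show ?thesis
    by (intro seed.expand) (simp add: smat_mutate mut_mat_mut_mat)
qed

end

section \<open>Mutation classes of seeds\<close>

lemma reach_sex: "reach S S' \<Longrightarrow> sex S' = sex S"
  and reach_sfr: "reach S S' \<Longrightarrow> sfr S' = sfr S"
  by (induction rule: reach.induct) auto

lemma reach_sidx: "reach S S' \<Longrightarrow> sidx S' = sidx S"
  by (simp add: sidx_def reach_sex reach_sfr)

lemma reach_is_seed:
  assumes "reach S S'" "is_seed S" shows "is_seed S'"
  using assms by (induction rule: reach.induct) (auto intro: is_seed_mutate)

lemma reach_frozen:
  assumes "reach S S'" "is_seed S" "i \<in> sfr S"
  shows "svar S' i = svar S i"
  using assms(1)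
proof (induction rule: reach.induct)
  case (step S' k)
  then have "k \<noteq> i" using assms(2,3) by (auto simp: is_seed_def reach_sex)
  then show ?case using step by (simp add: svar_mutate)
qed simp

lemma reach_trans:
  assumes "reach S2 S3" "reach S1 S2" shows "reach S1 S3"
  using assms by (induction rule: reach.induct) (auto intro: reach.step)

lemma reach_sym:
  assumes "reach S S'" "is_seed S" shows "reach S' S"
  using assms
proof (induction rule: reach.induct)
  case refl
  show ?case by (rule reach.refl)
next
  case (step S' k)
  then have "reach (mutate k S') (mutate k (mutate k S'))"
    by (intro reach.step reach.refl) simp
  then have "reach (mutate k S') S'"
    using mutate_mutate[of S' k] reach_is_seed[OF step(1)] step by simp
  then show ?case using reach_trans step by blast
qed

lemma clvars_reach:
  assumes "reach S S'" "is_seed S" shows "clvars S' = clvars S"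
proof -
  have "reach S' R \<longleftrightarrow> reach S R" for R
    by (rule iffI) (erule reach_trans, rule assms(1), erule reach_trans, rule reach_sym[OF assms])
  then show ?thesis by (simp add: clvars_def)
qed

lemma svar_in_clvars: "reach S S' \<Longrightarrow> i \<in> sidx S \<Longrightarrow> svar S' i \<in> clvars S"
  unfolding clvars_def by (intro CollectI exI[of _ S'] exI[of _ i]) (simp add: reach_sidx)

lemma clvars_subset_clusterAlg: "clvars S \<subseteq> clusterAlg S"
  unfolding clusterAlg_def by (auto intro: qalg_gen.gen)

text \<open>A rational form of the Laurent phenomenon: each mutation is a rational operation, so
  induction along mutations suffices.\<close>

lemma clusterAlg_subset_qfield_gen:
  "clusterAlg S \<subseteq> qfield_gen (svar S ` sidx S)"
proof -
  have "\<forall>i\<in>sidx S. svar S' i \<in> qfield_gen (svar S ` sidx S)" if "reach S S'" for S'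
    using that
  proof (induction rule: reach.induct)
    case refl
    then show ?case by (auto intro: qfield_gen_gen)
  next
    case (step S' k)
    then have "exchange_sum k S' \<in> qfield_gen (svar S ` sidx S)"
      unfolding exchange_sum_def
      by (intro qfield_gen_add qfield_gen_prod qfield_gen_power) (auto simp: reach_sidx)
    moreover have "k \<in> sidx S" using step by (simp add: reach_sex sidx_def)
    ultimately have "mut_var k S' \<in> qfield_gen (svar S ` sidx S)"
      unfolding mut_var_eq using step by (intro qfield_gen_divide) auto
    then show ?case using step by (simp add: svar_mutate)
  qed
  then show ?thesis
    unfolding clusterAlg_def by (intro qalg_gen_subset_qfield_genI) (auto simp: clvars_def reach_sidx)
qed

section \<open>Cluster automorphisms\<close>

context
  fixes S0 :: "('i, 'a::field_char_0) seed" and f :: "'a \<Rightarrow> 'a"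
  assumes f: "f \<in> cluster_auts S0"
begin

lemma aut_bij_betw: "bij_betw f (clusterAlg S0) (clusterAlg S0)"
  using f unfolding cluster_auts_def is_cluster_aut_def mem_Collect_eq by (elim conjE)

lemma aut_in: "z \<in> clusterAlg S0 \<Longrightarrow> f z \<in> clusterAlg S0"
  using aut_bij_betw by (rule bij_betw_apply)

lemma aut_inj_on: "inj_on f (clusterAlg S0)"
  using aut_bij_betw by (rule bij_betw_imp_inj_on)

lemma aut_add_mult:
  "\<forall>x\<in>clusterAlg S0. \<forall>y\<in>clusterAlg S0. f (x + y) = f x + f y \<and> f (x * y) = f x * f y"
  using f unfolding cluster_auts_def is_cluster_aut_def mem_Collect_eq by (elim conjE)

lemma aut_add: "x \<in> clusterAlg S0 \<Longrightarrow> y \<in> clusterAlg S0 \<Longrightarrow> f (x + y) = f x + f y"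
  and aut_mult: "x \<in> clusterAlg S0 \<Longrightarrow> y \<in> clusterAlg S0 \<Longrightarrow> f (x * y) = f x * f y"
  using aut_add_mult by simp_all

lemma aut_scale_all: "\<forall>q x. x \<in> clusterAlg S0 \<longrightarrow> f (of_rat q * x) = of_rat q * f x"
  using f unfolding cluster_auts_def is_cluster_aut_def mem_Collect_eq by (elim conjE)

lemma aut_1: "f 1 = 1"
  using f unfolding cluster_auts_def is_cluster_aut_def mem_Collect_eq by (elim conjE)

lemma aut_scale: "x \<in> clusterAlg S0 \<Longrightarrow> f (of_rat q * x) = of_rat q * f x"
  using aut_scale_all by simp

lemma aut_0: "f 0 = 0"
  using aut_scale[of 0 0] by (simp add: clusterAlg_def)

lemma aut_power: "x \<in> clusterAlg S0 \<Longrightarrow> f (x ^ n) = f x ^ n"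
proof (induction n)
  case (Suc n)
  then show ?case
    using aut_mult[of x "x ^ n"] qalg_gen_power[of x _ n] by (simp add: clusterAlg_def)
qed (simp add: aut_1)

lemma aut_sum:
  assumes "\<And>i. i \<in> I \<Longrightarrow> g i \<in> clusterAlg S0"
  shows "f (sum g I) = (\<Sum>i\<in>I. f (g i))"
  using assms
proof (induction I rule: infinite_finite_induct)
  case (insert i I)
  then have "f (g i + sum g I) = f (g i) + f (sum g I)"
    by (intro aut_add) (auto simp: clusterAlg_def intro: qalg_gen_sum)
  then show ?case using insert by simp
qed (simp_all add: aut_0)

lemma aut_prod:
  assumes "\<And>i. i \<in> I \<Longrightarrow> g i \<in> clusterAlg S0"
  shows "f (prod g I) = (\<Prod>i\<in>I. f (g i))"
  using assms
proof (induction I rule: infinite_finite_induct)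
  case (insert i I)
  then have "f (g i * prod g I) = f (g i) * f (prod g I)"
    by (intro aut_mult) (auto simp: clusterAlg_def intro: qalg_gen_prod)
  then show ?case using insert by simp
qed (simp_all add: aut_1)

end

text \<open>The map \<open>f\<close> carries \<open>S\<close> to \<open>S'\<close> along the
  relabelling \<open>\<pi>\<close>. The matrices are compared only up to a sign
  \<open>\<epsilon> j\<close> for each column, because an exchange binomial does not reveal the
  order of its two monomials. Indices refer to \<open>S0\<close>, whose index sets are shared by all
  reachable seeds.\<close>

definition seed_match ::
  "('i, 'a::field_char_0) seed \<Rightarrow> ('a \<Rightarrow> 'a) \<Rightarrow> ('i \<Rightarrow> 'i) \<Rightarrow> ('i \<Rightarrow> int) \<Rightarrow> ('i, 'a) seed \<Rightarrow> ('i, 'a) seed \<Rightarrow> bool"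
  where
  "seed_match S0 f \<pi> \<epsilon> S S' \<longleftrightarrow> reach S0 S \<and> reach S0 S'
     \<and> bij_betw \<pi> (sidx S0) (sidx S0) \<and> \<pi> ` sex S0 = sex S0
     \<and> (\<forall>i\<in>sidx S0. f (svar S i) = svar S' (\<pi> i))
     \<and> (\<forall>j\<in>sex S0. \<epsilon> j = 1 \<or> \<epsilon> j = - 1)
     \<and> (\<forall>i\<in>sidx S0. \<forall>j\<in>sex S0. smat S' (\<pi> i) (\<pi> j) = \<epsilon> j * smat S i j)"

section \<open>Transport of seeds along a cluster automorphism\<close>

context
  fixes S0 :: "('i, 'a::field_char_0) seed" and f :: "'a \<Rightarrow> 'a"
  assumes S0: "is_seed S0" and f: "f \<in> cluster_auts S0"
begin

lemma svar_in_clusterAlg: "reach S0 S \<Longrightarrow> i \<in> sidx S0 \<Longrightarrow> svar S i \<in> clusterAlg S0"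
  by (rule subsetD[OF clvars_subset_clusterAlg svar_in_clvars])

lemma aut_monomial:
  assumes S: "reach S0 S"
    and \<pi>: "\<And>i. i \<in> sidx S0 \<Longrightarrow> f (svar S i) = svar S' (\<pi> i)"
  shows "f (\<Prod>i\<in>sidx S0. svar S i ^ n i) = (\<Prod>i\<in>sidx S0. svar S' (\<pi> i) ^ n i)"
proof -
  have "svar S i ^ n i \<in> clusterAlg S0" if "i \<in> sidx S0" for i
    using svar_in_clusterAlg[OF S that] by (simp add: clusterAlg_def qalg_gen_power)
  then show ?thesis
    using \<pi> svar_in_clusterAlg[OF S] by (simp add: aut_prod[OF f] aut_power[OF f])
qed

lemma aut_exchange_sum:
  assumes S: "reach S0 S"
    and \<pi>: "\<And>i. i \<in> sidx S0 \<Longrightarrow> f (svar S i) = svar S' (\<pi> i)"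
  shows "f (exchange_sum k S) = (\<Prod>i\<in>sidx S0. svar S' (\<pi> i) ^ nat (smat S i k))
      + (\<Prod>i\<in>sidx S0. svar S' (\<pi> i) ^ nat (- smat S i k))"
proof -
  have "(\<Prod>i\<in>sidx S0. svar S i ^ n i) \<in> clusterAlg S0" for n :: "_ \<Rightarrow> nat"
    using svar_in_clusterAlg[OF S] unfolding clusterAlg_def
    by (intro qalg_gen_prod qalg_gen_power)
  then show ?thesis
    unfolding exchange_sum_def reach_sidx[OF S]
    by (simp add: aut_add[OF f] aut_monomial[OF S \<pi>])
qed

lemma exchange_sum_eq_mult:
  assumes "reach S0 S" "k \<in> sex S0"
  shows "exchange_sum k S = svar S k * mut_var k S"
  using svar_nonzero[OF reach_is_seed[OF assms(1) S0], of k] assms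
  by (simp add: mut_var_eq sidx_def reach_sex)

lemma mut_var_in_clusterAlg:
  assumes "reach S0 S" "k \<in> sex S0"
  shows "mut_var k S \<in> clusterAlg S0"
  using svar_in_clusterAlg[of "mutate k S" k] reach.step[OF assms(1), of k] assms
  by (simp add: svar_mutate reach_sex sidx_def)

text \<open>Compatibility with mutation at \<open>k\<close> equates the image of the binomial of
  \<open>S\<close> at \<open>k\<close> with that of \<open>S'\<close> at \<open>\<pi> k\<close>.
  Algebraic independence then compares their monomials.\<close>

lemma seed_match_exists: "\<exists>\<pi> \<epsilon> S S'. seed_match S0 f \<pi> \<epsilon> S S'"
proof -
  obtain S S' where S: "reach S0 S" and S': "reach S0 S'"
    and img: "f ` (svar S ` sidx S) = svar S' ` sidx S'"
    and imgex: "f ` (svar S ` sex S) = svar S' ` sex S'"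
    and mut: "\<forall>k\<in>sex S. \<forall>k'\<in>sex S'. svar S' k' = f (svar S k) \<longrightarrow> f (mut_var k S) = mut_var k' S'"
    using f unfolding cluster_auts_def is_cluster_aut_def mem_Collect_eq by (elim conjE exE)
  define I where "I = sidx S0"
  have sub: "sex S0 \<subseteq> I" by (simp add: I_def sidx_def)
  note idx = reach_sidx[OF S, folded I_def] reach_sidx[OF S', folded I_def] reach_sex[OF S] reach_sex[OF S']
  note img = img[unfolded idx] and imgex = imgex[unfolded idx] and mut = mut[unfolded idx]
  have sS: "is_seed S" and sS': "is_seed S'"
    using reach_is_seed[OF S S0] reach_is_seed[OF S' S0] by simp_all
  have finI: "finite I" using finite_sidx[OF S0] by (simp add: I_def)
  have injS: "inj_on (svar S) I" and injS': "inj_on (svar S') I"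
    and indS': "alg_indep I (svar S')"
    using sS sS' unfolding is_seed_def idx by auto
  have memS: "svar S ` I \<subseteq> clusterAlg S0"
    using svar_in_clusterAlg[OF S] by (auto simp: I_def)
  have injfS: "inj_on (\<lambda>i. f (svar S i)) I"
    using comp_inj_on[OF injS inj_on_subset[OF aut_inj_on[OF f] memS]] by (simp add: comp_def)
  define \<pi> where "\<pi> = (\<lambda>i. inv_into I (svar S') (f (svar S i)))"
  have \<pi>: "\<pi> i \<in> I" "svar S' (\<pi> i) = f (svar S i)" if "i \<in> I" for i
  proof -
    have "f (svar S i) \<in> svar S' ` I" using img that by blast
    then show "\<pi> i \<in> I" "svar S' (\<pi> i) = f (svar S i)"
      unfolding \<pi>_def by (auto intro: inv_into_into f_inv_into_f)
  qed
  have inj\<pi>: "inj_on \<pi> I"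
  proof (rule inj_onI)
    fix i j assume ij: "i \<in> I" "j \<in> I" "\<pi> i = \<pi> j"
    then have "f (svar S i) = f (svar S j)" using \<pi>(2) by metis
    then show "i = j" using injfS ij by (auto dest: inj_onD)
  qed
  have bij: "bij_betw \<pi> I I"
    using inj\<pi> \<pi>(1) finI by (simp add: bij_betw_def endo_inj_surj image_subsetI)
  have "\<pi> k \<in> sex S0" if k: "k \<in> sex S0" for k
  proof -
    have kI: "k \<in> I" using k sub by blast
    have "f (svar S k) \<in> svar S' ` sex S0" using imgex k by blast
    then obtain k' where k': "k' \<in> sex S0" "svar S' (\<pi> k) = svar S' k'"
      using \<pi>(2)[OF kI] by auto
    then have "\<pi> k = k'" using inj_onD[OF injS' k'(2)] \<pi>(1)[OF kI] sub by blast
    then show ?thesis using k' by simp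
  qed
  then have ex: "\<pi> ` sex S0 = sex S0"
    using inj_on_subset[OF inj\<pi> sub] finite_subset[OF sub finI] by (intro endo_inj_surj) auto
  have col: "\<exists>e::int. (e = 1 \<or> e = - 1) \<and> (\<forall>i\<in>I. smat S' (\<pi> i) (\<pi> k) = e * smat S i k)"
    if k: "k \<in> sex S0" for k
  proof -
    have \<pi>k: "\<pi> k \<in> sex S0" using ex k by blast
    have kI: "k \<in> I" using k sub by blast
    have "f (exchange_sum k S) = f (svar S k) * f (mut_var k S)"
      using exchange_sum_eq_mult[OF S k] mut_var_in_clusterAlg[OF S k] memS kI
      by (auto simp: aut_mult[OF f])
    also have "\<dots> = svar S' (\<pi> k) * mut_var (\<pi> k) S'"
      using mut \<pi>k k \<pi>(2)[OF kI] by simp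
    also have "\<dots> = exchange_sum (\<pi> k) S'"
      using exchange_sum_eq_mult[OF S' \<pi>k] by simp
    finally have fe: "f (exchange_sum k S) = exchange_sum (\<pi> k) S'" .
    \<comment> \<open>Exponents are cut off outside \<open>I\<close>, so that equal monomials have
      equal exponent functions.\<close>
    define restr :: "('i \<Rightarrow> nat) \<Rightarrow> 'i \<Rightarrow> nat" where "restr = (\<lambda>n j. if j \<in> I then n j else 0)"
    define a where "a = restr (\<lambda>j. nat (smat S (inv_into I \<pi> j) k))"
    define b where "b = restr (\<lambda>j. nat (- smat S (inv_into I \<pi> j) k))"
    define c where "c = restr (\<lambda>j. nat (smat S' j (\<pi> k)))"
    define d where "d = restr (\<lambda>j. nat (- smat S' j (\<pi> k)))"
    have inv: "inv_into I \<pi> (\<pi> i) = i" if "i \<in> I" for i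
      using inj\<pi> that by simp
    have re: "(\<Prod>i\<in>I. svar S' (\<pi> i) ^ n i) = (\<Prod>j\<in>I. svar S' j ^ restr (\<lambda>j. n (inv_into I \<pi> j)) j)"
      for n :: "'i \<Rightarrow> nat"
    proof -
      have "(\<Prod>i\<in>I. svar S' (\<pi> i) ^ n i) =
          (\<Prod>i\<in>I. svar S' (\<pi> i) ^ restr (\<lambda>j. n (inv_into I \<pi> j)) (\<pi> i))"
        by (intro prod.cong) (auto simp: restr_def inv \<pi>(1))
      also have "\<dots> = (\<Prod>j\<in>I. svar S' j ^ restr (\<lambda>j. n (inv_into I \<pi> j)) j)"
        by (rule prod.reindex_bij_betw[OF bij])
      finally show ?thesis .
    qed
    have "f (exchange_sum k S) = (\<Prod>i\<in>I. svar S' (\<pi> i) ^ nat (smat S i k))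
        + (\<Prod>i\<in>I. svar S' (\<pi> i) ^ nat (- smat S i k))"
      unfolding I_def by (rule aut_exchange_sum[OF S]) (simp add: \<pi>(2)[unfolded I_def])
    then have "(\<Prod>i\<in>I. svar S' i ^ a i) + (\<Prod>i\<in>I. svar S' i ^ b i) = f (exchange_sum k S)"
      unfolding a_def b_def by (simp only: re)
    also have "\<dots> = (\<Prod>i\<in>I. svar S' i ^ c i) + (\<Prod>i\<in>I. svar S' i ^ d i)"
      unfolding fe unfolding exchange_sum_def idx by (simp add: c_def d_def restr_def)
    finally have "a = c \<and> b = d \<or> a = d \<and> b = c"
      by (intro alg_indep_monomial_pairs_eq[OF indS']) (auto simp: a_def b_def c_def d_def restr_def)
    then show ?thesis
    proof
      \<comment> \<open>An integer m is determined by the pair \<open>nat m\<close>,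
        \<open>nat (- m)\<close>. Equal pairs give the sign 1 for the column, swapped pairs give
        -1.\<close>
      assume "a = c \<and> b = d"
      then have "a (\<pi> i) = c (\<pi> i)" "b (\<pi> i) = d (\<pi> i)" for i by auto
      then have "smat S' (\<pi> i) (\<pi> k) = 1 * smat S i k" if "i \<in> I" for i
        using inv[OF that] \<pi>(1)[OF that] unfolding a_def b_def c_def d_def restr_def
        by (smt (verit) int_nat_eq)
      then show ?thesis by blast
    next
      assume "a = d \<and> b = c"
      then have "a (\<pi> i) = d (\<pi> i)" "b (\<pi> i) = c (\<pi> i)" for i by auto
      then have "smat S' (\<pi> i) (\<pi> k) = - 1 * smat S i k" if "i \<in> I" for i
        using inv[OF that] \<pi>(1)[OF that] unfolding a_def b_def c_def d_def restr_def
        by (smt (verit) int_nat_eq)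
      then show ?thesis by blast
    qed
  qed
  then obtain \<epsilon> :: "'i \<Rightarrow> int" where
    "\<And>k. k \<in> sex S0 \<Longrightarrow> \<epsilon> k = 1 \<or> \<epsilon> k = - 1"
    "\<And>k i. k \<in> sex S0 \<Longrightarrow> i \<in> I \<Longrightarrow> smat S' (\<pi> i) (\<pi> k) = \<epsilon> k * smat S i k"
    by metis
  then have "seed_match S0 f \<pi> \<epsilon> S S'"
    unfolding seed_match_def using S S' bij ex \<pi>(2) by (simp add: I_def)
  then show ?thesis by blast
qed

text \<open>A sign on column \<open>k\<close> merely swaps the two monomials of the exchange
  relation, so new variables correspond to each other; the same \<open>\<pi>\<close> and
  \<open>\<epsilon>\<close> continue to serve.\<close>

lemma seed_match_mutate:
  assumes m: "seed_match S0 f \<pi> \<epsilon> S S'" and k: "k \<in> sex S0"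
  shows "seed_match S0 f \<pi> \<epsilon> (mutate k S) (mutate (\<pi> k) S')"
proof -
  have S: "reach S0 S" and S': "reach S0 S'" and bij: "bij_betw \<pi> (sidx S0) (sidx S0)"
    and ex: "\<pi> ` sex S0 = sex S0"
    and var: "\<And>i. i \<in> sidx S0 \<Longrightarrow> f (svar S i) = svar S' (\<pi> i)"
    and \<epsilon>: "\<And>j. j \<in> sex S0 \<Longrightarrow> \<epsilon> j = 1 \<or> \<epsilon> j = - 1"
    and mat: "\<And>i j. i \<in> sidx S0 \<Longrightarrow> j \<in> sex S0 \<Longrightarrow> smat S' (\<pi> i) (\<pi> j) = \<epsilon> j * smat S i j"
    using m unfolding seed_match_def by auto
  have sS: "is_seed S" and sS': "is_seed S'"
    using reach_is_seed[OF S S0] reach_is_seed[OF S' S0] by simp_all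
  have \<pi>ex: "\<pi> j \<in> sex S0" if "j \<in> sex S0" for j using ex that by blast
  have ex_idx: "j \<in> sidx S0" if "j \<in> sex S0" for j using that by (simp add: sidx_def)
  have \<pi>eq: "\<pi> i = \<pi> j \<longleftrightarrow> i = j" if "i \<in> sidx S0" "j \<in> sidx S0" for i j
    using bij that by (auto simp: bij_betw_def dest: inj_onD)
  have ex_sum: "exchange_sum (\<pi> k) S' = f (exchange_sum k S)"
  proof -
    have "exchange_sum (\<pi> k) S' = (\<Prod>i\<in>sidx S0. svar S' (\<pi> i) ^ nat (smat S' (\<pi> i) (\<pi> k)))
        + (\<Prod>i\<in>sidx S0. svar S' (\<pi> i) ^ nat (- smat S' (\<pi> i) (\<pi> k)))"
      unfolding exchange_sum_def reach_sidx[OF S']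
      using prod.reindex_bij_betw[OF bij, of "\<lambda>i. svar S' i ^ nat (smat S' i (\<pi> k))"]
        prod.reindex_bij_betw[OF bij, of "\<lambda>i. svar S' i ^ nat (- smat S' i (\<pi> k))"] by simp
    also have "\<dots> = f (exchange_sum k S)"
      using \<epsilon>[OF k] by (auto simp: aut_exchange_sum[OF S var] mat k add.commute)
    finally show ?thesis .
  qed
  have mv: "f (mut_var k S) = mut_var (\<pi> k) S'"
  proof -
    have "svar S' (\<pi> k) * mut_var (\<pi> k) S' = f (svar S k * mut_var k S)"
      using ex_sum exchange_sum_eq_mult[OF S k] exchange_sum_eq_mult[OF S' \<pi>ex[OF k]] by simp
    also have "\<dots> = svar S' (\<pi> k) * f (mut_var k S)"
      using svar_in_clusterAlg[OF S ex_idx[OF k]] mut_var_in_clusterAlg[OF S k] var[OF ex_idx[OF k]]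
      by (simp add: aut_mult[OF f])
    finally show ?thesis
      using svar_nonzero[OF sS', of "\<pi> k"] \<pi>ex[OF k] by (simp add: reach_sidx[OF S'] ex_idx)
  qed
  have "f (svar (mutate k S) i) = svar (mutate (\<pi> k) S') (\<pi> i)" if "i \<in> sidx S0" for i
    using mv var that \<pi>eq[OF that ex_idx[OF k]] by (simp add: svar_mutate)
  moreover have "smat (mutate (\<pi> k) S') (\<pi> i) (\<pi> j) = \<epsilon> j * smat (mutate k S) i j"
    if i: "i \<in> sidx S0" and j: "j \<in> sex S0" for i j
  proof (cases "i = k \<or> j = k")
    case True
    then show ?thesis using mat[OF i j] by (auto simp: smat_mutate mut_mat_def)
  next
    case False
    then have ne: "\<pi> i \<noteq> \<pi> k" "\<pi> j \<noteq> \<pi> k" using \<pi>eq i j k ex_idx by auto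
    \<comment> \<open>sign-skew-symmetry forces the column signs of adjacent exchange indices to agree\<close>
    have "smat S k j = 0 \<or> \<epsilon> k = \<epsilon> j"
    proof -
      have "sgn (smat S' (\<pi> k) (\<pi> j)) = - sgn (smat S' (\<pi> j) (\<pi> k))"
        using sS' \<pi>ex j k reach_sex[OF S']
        by (intro skew_symmetrizable_sgn[of "sex S'"]) (auto simp: is_seed_def)
      moreover have "sgn (smat S k j) = - sgn (smat S j k)"
        using sS j k reach_sex[OF S]
        by (intro skew_symmetrizable_sgn[of "sex S"]) (auto simp: is_seed_def)
      ultimately have "\<epsilon> j * sgn (smat S k j) = \<epsilon> k * sgn (smat S k j)"
        using \<epsilon>[OF j] \<epsilon>[OF k] by (auto simp: mat ex_idx j k)
      then show ?thesis by (auto simp: sgn_eq_0_iff)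
    qed
    \<comment> \<open>If \<open>smat S k j = 0\<close>, the correction term vanishes on both sides.
      If the signs agree, the product inside \<open>max\<close> is unchanged and \<open>sgn\<close>
      contributes exactly the factor \<open>\<epsilon> j\<close>.\<close>
    then show ?thesis
      using \<epsilon>[OF j] \<epsilon>[OF k] False ne
      by (auto simp: smat_mutate mut_mat_def mat i j k ex_idx)
  qed
  ultimately show ?thesis
    unfolding seed_match_def using m[unfolded seed_match_def] k \<pi>ex[OF k]
      reach.step[OF S, of k] reach.step[OF S', of "\<pi> k"] by (simp add: reach_sex[OF S] reach_sex[OF S'])
qed

text \<open>The match given at one seed is carried along a mutation path to a seed containing
  \<open>z\<close>; the seed matched with it contains \<open>f z\<close>.\<close>

lemma aut_clvars:
  assumes "z \<in> clvars S0" shows "f z \<in> clvars S0"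
proof -
  obtain \<pi> \<epsilon> S S' where m: "seed_match S0 f \<pi> \<epsilon> S S'" using seed_match_exists by blast
  then have S: "reach S0 S" by (simp add: seed_match_def)
  obtain R i where R: "reach S0 R" "i \<in> sidx S0" "z = svar R i"
    using assms unfolding clvars_def by (auto simp: reach_sidx)
  have "reach S R" using reach_trans[OF R(1)] reach_sym[OF S S0] by blast
  then have "\<exists>R'. seed_match S0 f \<pi> \<epsilon> R R'"
  proof (induction rule: reach.induct)
    case refl
    then show ?case using m by blast
  next
    case (step R k)
    then obtain R' where R': "seed_match S0 f \<pi> \<epsilon> R R'" by blast
    then have "k \<in> sex S0" using step(2) reach_sex by (auto simp: seed_match_def)
    then show ?case using seed_match_mutate[OF R'] by blast
  qed
  then obtain R' where R': "seed_match S0 f \<pi> \<epsilon> R R'" by blast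
  then have "reach S0 R'" "f z = svar R' (\<pi> i)" "\<pi> i \<in> sidx S0"
    using R(2,3) by (auto simp: seed_match_def intro: bij_betw_apply)
  then show ?thesis by (simp add: svar_in_clvars)
qed

lemma aut_frozen:
  assumes "z \<in> svar S0 ` sfr S0" shows "f z \<in> svar S0 ` sfr S0"
proof -
  obtain \<pi> \<epsilon> S S' where m: "seed_match S0 f \<pi> \<epsilon> S S'" using seed_match_exists by blast
  then have S: "reach S0 S" and S': "reach S0 S'" and bij: "bij_betw \<pi> (sidx S0) (sidx S0)"
    and ex: "\<pi> ` sex S0 = sex S0"
    and var: "\<And>i. i \<in> sidx S0 \<Longrightarrow> f (svar S i) = svar S' (\<pi> i)"
    unfolding seed_match_def by auto
  obtain i where i: "i \<in> sfr S0" "z = svar S0 i" using assms by blast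
  then have "i \<in> sidx S0" "i \<notin> sex S0" using S0 by (auto simp: sidx_def is_seed_def)
  have "\<pi> i \<notin> sex S0"
  proof
    assume "\<pi> i \<in> sex S0"
    then obtain j where "j \<in> sex S0" "\<pi> i = \<pi> j" using ex by blast
    then have "i = j"
      using bij \<open>i \<in> sidx S0\<close> by (auto simp: bij_betw_def sidx_def dest: inj_onD)
    then show False using \<open>j \<in> sex S0\<close> \<open>i \<notin> sex S0\<close> by simp
  qed
  moreover have "\<pi> i \<in> sidx S0" using bij \<open>i \<in> sidx S0\<close> by (auto simp: bij_betw_def)
  ultimately have "\<pi> i \<in> sfr S0" by (simp add: sidx_def)
  have "f z = svar S' (\<pi> i)"
    using var[OF \<open>i \<in> sidx S0\<close>] reach_frozen[OF S S0 i(1)] i(2) by simp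
  then show ?thesis using reach_frozen[OF S' S0] \<open>\<pi> i \<in> sfr S0\<close> by simp
qed

end

section \<open>Fixed algebras\<close>

text \<open>The variables outside \<open>J\<close> are removed one by one; \<open>Y\<close> plays
  the role of the set of conjugates of \<open>z\<close>.\<close>

lemma qfield_gen_conjugates:
  assumes "finite D" "finite J" "D \<inter> J = {}" "alg_indep (D \<union> J) x"
    and "z \<in> qfield_gen (x ` (D \<union> J))"
    and Y: "finite Y" "z \<in> Y"
    and sym: "\<And>k. (\<Sum>X | X \<subseteq> Y \<and> card X = k. \<Prod>X) \<in> qfield_gen (x ` J)"
  shows "z \<in> qfield_gen (x ` J)"
  using assms(1,3-5)
proof (induction D)
  case (insert k D)
  have k: "k \<notin> D \<union> J" "finite (D \<union> J)" using insert assms(2) by auto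
  have ind: "alg_indep (insert k (D \<union> J)) x" using insert by simp
  have tr: "transcendental_over (qalg_gen (x ` (D \<union> J))) (x k)"
    using alg_indep_insertD_transcendental[OF ind] k by simp
  have "z \<in> qfield_gen (insert (x k) (x ` (D \<union> J)))" using insert by simp
  moreover have "qfield_gen (x ` J) \<subseteq> qfield_gen (x ` (D \<union> J))"
    by (intro qfield_gen_mono) auto
  ultimately have "z \<in> qfield_gen (x ` (D \<union> J))"
    using sym by (intro qfield_gen_insert_conjugates[OF tr _ Y]) auto
  then show ?case
    using insert alg_indep_insertD[OF ind] k by auto
qed simp

text \<open>Being injective, \<open>f\<close> permutes the finite set \<open>Y\<close>, and hence
  its subsets of size \<open>k\<close>.\<close>

lemma aut_elementary_symmetric:
  assumes f: "f \<in> cluster_auts S0" and Y: "finite Y" "Y \<subseteq> clusterAlg S0" "f ` Y \<subseteq> Y"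
  shows "f (\<Sum>X | X \<subseteq> Y \<and> card X = k. \<Prod>X) = (\<Sum>X | X \<subseteq> Y \<and> card X = k. \<Prod>X)"
proof -
  let ?P = "{X. X \<subseteq> Y \<and> card X = k}"
  have inj: "inj_on f Y" using aut_inj_on[OF f] Y(2) by (rule inj_on_subset)
  have finP: "finite ?P" using Y(1) by simp
  have injP: "inj_on (image f) ?P"
    using inj_on_image_Pow[OF inj] by (rule inj_on_subset) auto
  have "image f ` ?P \<subseteq> ?P"
    using Y(3) inj by (auto simp: card_image inj_on_subset)
  then have bij: "bij_betw (image f) ?P ?P"
    using injP finP by (simp add: bij_betw_def endo_inj_surj)
  have "f (\<Sum>X\<in>?P. \<Prod>X) = (\<Sum>X\<in>?P. f (\<Prod>X))"
    using Y(2) by (intro aut_sum[OF f]) (auto simp: clusterAlg_def intro!: qalg_gen_prod)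
  also have "\<dots> = (\<Sum>X\<in>?P. \<Prod>(f ` X))"
  proof (rule sum.cong[OF HOL.refl])
    fix X assume "X \<in> ?P"
    then have X: "X \<subseteq> Y" by simp
    then have "f (\<Prod>X) = (\<Prod>x\<in>X. f x)" using Y(2) by (intro aut_prod[OF f]) auto
    also have "\<dots> = \<Prod>(f ` X)"
      using inj_on_subset[OF inj X] by (simp add: prod.reindex)
    finally show "f (\<Prod>X) = \<Prod>(f ` X)" .
  qed
  also have "\<dots> = (\<Sum>X\<in>?P. \<Prod>X)" by (rule sum.reindex_bij_betw[OF bij])
  finally show ?thesis .
qed

lemma clusterAlg_reach: "reach S S' \<Longrightarrow> is_seed S \<Longrightarrow> clusterAlg S' = clusterAlg S"
  by (simp add: clusterAlg_def clvars_reach)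

lemma sidx_subseed: "I0 \<subseteq> sex S \<Longrightarrow> I0 \<inter> I1 = {} \<Longrightarrow> sidx (subseed S I0 I1) = sidx S - I1"
  by (auto simp: subseed_def sidx_def)

lemma svar_subseed [simp]: "svar (subseed S I0 I1) = svar S"
  by (simp add: subseed_def)

section \<open>Orbits and invariants of a group of automorphisms\<close>

context
  fixes S0 :: "('i, 'a::field_char_0) seed" and H :: "('a \<Rightarrow> 'a) set"
  assumes S0: "is_seed S0" and H: "aut_subgroup S0 H"
begin

lemma aut_subgroup_auts: "f \<in> H \<Longrightarrow> f \<in> cluster_auts S0"
  using H unfolding aut_subgroup_def by auto

lemma orbit_subset: "z \<in> clusterAlg S0 \<Longrightarrow> orbit H z \<subseteq> clusterAlg S0"
  using aut_in aut_subgroup_auts by (auto simp: orbit_def)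

lemma orbit_self:
  assumes "z \<in> clusterAlg S0" shows "z \<in> orbit H z"
proof -
  obtain f where f: "f \<in> H" using H unfolding aut_subgroup_def by auto
  have "\<forall>f\<in>H. \<exists>g\<in>H. \<forall>z\<in>clusterAlg S0. g (f z) = z"
    using H unfolding aut_subgroup_def by (elim conjE)
  then obtain g where g: "g \<in> H" "\<forall>z\<in>clusterAlg S0. g (f z) = z"
    using f by blast
  \<comment> \<open>Automorphisms are compared only on the cluster algebra, so
    \<open>g \<circ> f\<close> takes the place of the identity map.\<close>
  then have "g \<circ> f \<in> H" using H f unfolding aut_subgroup_def by auto
  moreover have "z = (g \<circ> f) z" using g(2) assms by simp
  ultimately show ?thesis unfolding orbit_def by (metis image_eqI)
qed

lemma orbit_invariant:
  assumes "f \<in> H" shows "f ` orbit H z \<subseteq> orbit H z"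
proof
  fix y assume "y \<in> f ` orbit H z"
  then obtain g where g: "g \<in> H" "y = (f \<circ> g) z" by (auto simp: orbit_def)
  moreover have "f \<circ> g \<in> H" using H assms g(1) unfolding aut_subgroup_def by auto
  ultimately show "y \<in> orbit H z" unfolding orbit_def by (auto intro: rev_image_eqI)
qed

text \<open>The first assumption in \<open>fixed\<close> places the symmetric functions of the orbit
  in the field of the subcluster \<open>J\<close>. The second makes that subcluster invariant, which
  brings \<open>z\<close> back into the fixed algebra.\<close>

lemma finite_orbit_in_fixed_alg:
  assumes S: "reach S0 S" and J: "J \<subseteq> sidx S"
    and fixed: "fixed_alg S0 H \<subseteq> qfield_gen (svar S ` J)" "svar S ` J \<subseteq> fixed_alg S0 H"
    and z: "z \<in> clusterAlg S0" "finite (orbit H z)"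
  shows "z \<in> fixed_alg S0 H"
proof -
  have sS: "is_seed S" using reach_is_seed[OF S S0] .
  have sym: "(\<Sum>X | X \<subseteq> orbit H z \<and> card X = k. \<Prod>X) \<in> fixed_alg S0 H" for k
  proof -
    have "(\<Sum>X | X \<subseteq> orbit H z \<and> card X = k. \<Prod>X) \<in> clusterAlg S0"
      unfolding clusterAlg_def
      by (intro qalg_gen_sum qalg_gen_prod) (use orbit_subset[OF z(1)] in \<open>auto simp: clusterAlg_def\<close>)
    then show ?thesis
      using aut_elementary_symmetric[OF aut_subgroup_auts z(2) orbit_subset[OF z(1)] orbit_invariant]
      by (simp add: fixed_alg_def)
  qed
  have I: "(sidx S - J) \<union> J = sidx S" using J by blast
  have finJ: "finite J" using finite_subset[OF J finite_sidx[OF sS]] .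
  have "z \<in> qfield_gen (svar S ` J)"
  proof (rule qfield_gen_conjugates[where D = "sidx S - J" and Y = "orbit H z"])
    show "alg_indep (sidx S - J \<union> J) (svar S)" using sS by (simp only: I is_seed_def)
    show "z \<in> qfield_gen (svar S ` (sidx S - J \<union> J))"
      unfolding I using z(1) clusterAlg_subset_qfield_gen[of S] clusterAlg_reach[OF S S0] by auto
    show "z \<in> orbit H z" using orbit_self[OF z(1)] .
    show "(\<Sum>X | X \<subseteq> orbit H z \<and> card X = k. \<Prod>X) \<in> qfield_gen (svar S ` J)" for k
      using sym fixed(1) by (rule subsetD[rotated])
  qed (use finJ finite_sidx[OF sS] z(2) in auto)
  then obtain a b where ab: "z = a / b" "a \<in> qalg_gen (svar S ` J)" "b \<in> qalg_gen (svar S ` J)"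
    unfolding qfield_gen_def by blast
  have gen_fixed: "u \<in> clusterAlg S0 \<and> (\<forall>f\<in>H. f u = u)" if "u \<in> qalg_gen (svar S ` J)" for u
    using that
  proof induction
    case (gen u)
    then show ?case using fixed(2) by (auto simp: fixed_alg_def)
  next
    case (rat q)
    have "f (of_rat q) = of_rat q" if "f \<in> H" for f
      using aut_scale[OF aut_subgroup_auts[OF that], of 1 q] aut_1[OF aut_subgroup_auts[OF that]]
      by (simp add: clusterAlg_def)
    then show ?case by (simp add: clusterAlg_def qalg_gen.rat)
  next
    case (add u v)
    have "f (u + v) = u + v" if "f \<in> H" for f
      using aut_add[OF aut_subgroup_auts[OF that], of u v] add.IH that by auto
    then show ?case using add.IH by (simp add: clusterAlg_def qalg_gen.add)
  next
    case (mult u v)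
    have "f (u * v) = u * v" if "f \<in> H" for f
      using aut_mult[OF aut_subgroup_auts[OF that], of u v] mult.IH that by auto
    then show ?case using mult.IH by (simp add: clusterAlg_def qalg_gen.mult)
  qed
  have "f z = z" if f: "f \<in> H" for f
  proof (cases "b = 0")
    case True
    then show ?thesis using ab(1) aut_0[OF aut_subgroup_auts[OF f]] by simp
  next
    case False
    \<comment> \<open>Multiplicativity of \<open>f\<close> is known only on the cluster algebra, so
      it is applied to the product \<open>z * b = a\<close> rather than to the quotient.\<close>
    have "f (z * b) = f z * f b"
      using aut_mult[OF aut_subgroup_auts[OF f] z(1)] gen_fixed[OF ab(3)] by simp
    moreover have "f b = b" "f a = a" using gen_fixed ab(2,3) f by auto
    moreover have "z * b = a" using ab(1) False by simp
    ultimately have "f z * b = z * b" by metis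
    then show ?thesis using False by simp
  qed
  then show ?thesis using z(1) by (simp add: fixed_alg_def)
qed

lemma qbasis_support_invariant:
  assumes basis: "qbasis (clusterAlg S0) W" and f: "f \<in> cluster_auts S0" and fW: "f ` W \<subseteq> W"
    and T: "finite T" "T \<subseteq> W" "\<And>t. t \<in> T \<Longrightarrow> c t \<noteq> 0"
    and fix_f: "f (\<Sum>t\<in>T. of_rat (c t) * t) = (\<Sum>t\<in>T. of_rat (c t) * t)"
  shows "f ` T \<subseteq> T"
proof (rule ccontr)
  assume "\<not> f ` T \<subseteq> T"
  then obtain u where u: "u \<in> T" "f u \<notin> T" by blast
  have WA: "W \<subseteq> clusterAlg S0" using basis unfolding qbasis_def by (elim conjE)
  have TA: "T \<subseteq> clusterAlg S0" using T(2) WA by blast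
  have inj: "inj_on f T" using inj_on_subset[OF aut_inj_on[OF f] TA] .
  let ?U = "T \<union> f ` T"
  \<comment> \<open>Both coefficient families are extended by zero to \<open>?U\<close>. At
    \<open>f u\<close> the first is 0 and the second is \<open>c u\<close>, which is
    nonzero.\<close>
  define d where "d = (\<lambda>w. if w \<in> T then c w else 0)"
  define d' where "d' = (\<lambda>w. if w \<in> f ` T then c (inv_into T f w) else 0)"
  have "(\<Sum>w\<in>?U. of_rat (d w) * w) = (\<Sum>t\<in>T. of_rat (c t) * t)"
    using T(1) by (intro sum.mono_neutral_cong_right) (auto simp: d_def)
  moreover have "(\<Sum>w\<in>?U. of_rat (d' w) * w) = (\<Sum>t\<in>T. of_rat (c t) * t)"
  proof -
    have "(\<Sum>w\<in>?U. of_rat (d' w) * w) = (\<Sum>w\<in>f ` T. of_rat (d' w) * w)"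
      using T(1) by (intro sum.mono_neutral_right) (auto simp: d'_def)
    also have "\<dots> = (\<Sum>t\<in>T. of_rat (c t) * f t)"
      using inj by (simp add: sum.reindex d'_def)
    also have "\<dots> = (\<Sum>t\<in>T. f (of_rat (c t) * t))"
      using TA by (intro sum.cong) (auto simp: aut_scale[OF f])
    also have "\<dots> = f (\<Sum>t\<in>T. of_rat (c t) * t)"
      using TA by (intro aut_sum[OF f, symmetric])
        (auto simp: clusterAlg_def intro!: qalg_gen.mult[OF qalg_gen.rat])
    finally show ?thesis using fix_f by simp
  qed
  ultimately have "(\<Sum>w\<in>?U. of_rat (d w - d' w) * w) = 0"
    by (simp add: of_rat_diff left_diff_distrib sum_subtractf)
  moreover have "finite ?U" "?U \<subseteq> W" using T fW by auto
  moreover have "\<forall>T (c :: 'a \<Rightarrow> rat). finite T \<longrightarrow> T \<subseteq> W \<longrightarrow>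
          (\<Sum>t\<in>T. of_rat (c t) * t) = 0 \<longrightarrow> (\<forall>t\<in>T. c t = 0)"
    using basis unfolding qbasis_def by (elim conjE)
  ultimately have "\<forall>w\<in>?U. d w - d' w = 0" by meson
  then have "d (f u) = d' (f u)" using u(1) by auto
  then have "c u = 0" using u inj by (simp add: d_def d'_def)
  then show False using T(3) u(1) by blast
qed

lemma fixed_alg_expansion:
  assumes basis: "qbasis (clusterAlg S0) W" and fW: "\<And>f. f \<in> H \<Longrightarrow> f ` W \<subseteq> W"
    and z: "z \<in> fixed_alg S0 H"
  obtains T and c :: "'a \<Rightarrow> rat" where "T \<subseteq> W" "\<And>t. t \<in> T \<Longrightarrow> finite (orbit H t)"
    "z = (\<Sum>t\<in>T. of_rat (c t) * t)"
proof -
  have "\<forall>v\<in>clusterAlg S0. \<exists>T (c :: 'a \<Rightarrow> rat). finite T \<and> T \<subseteq> W \<and> v = (\<Sum>t\<in>T. of_rat (c t) * t)"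
    using basis unfolding qbasis_def by (elim conjE)
  moreover have zA: "z \<in> clusterAlg S0" and zf: "\<And>f. f \<in> H \<Longrightarrow> f z = z"
    using z unfolding fixed_alg_def by auto
  ultimately obtain T' and c :: "'a \<Rightarrow> rat"
    where T': "finite T'" "T' \<subseteq> W" "z = (\<Sum>t\<in>T'. of_rat (c t) * t)"
    by meson
  \<comment> \<open>Terms with zero coefficient are discarded, leaving the true support. It is
    finite and stable under \<open>H\<close>, so it contains the orbit of each of its
    elements.\<close>
  define T where "T = {t \<in> T'. c t \<noteq> 0}"
  have T: "finite T" "T \<subseteq> W" using T' by (auto simp: T_def)
  have zT: "z = (\<Sum>t\<in>T. of_rat (c t) * t)"
    unfolding T'(3) T_def using T'(1) by (intro sum.mono_neutral_right) auto
  have "f ` T \<subseteq> T" if "f \<in> H" for f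
  proof (rule qbasis_support_invariant[OF basis aut_subgroup_auts[OF that] fW[OF that] T])
    show "c t \<noteq> 0" if "t \<in> T" for t using that by (simp add: T_def)
    show "f (\<Sum>t\<in>T. of_rat (c t) * t) = (\<Sum>t\<in>T. of_rat (c t) * t)"
      unfolding zT[symmetric] by (rule zf[OF that])
  qed
  then have "finite (orbit H t)" if "t \<in> T" for t
    using that T(1) by (intro finite_subset[of "orbit H t" T]) (auto simp: orbit_def)
  then show ?thesis using that T(2) zT by blast
qed

lemma finite_orbit_of_support:
  assumes orb: "finite (orbit H t)" and E: "\<And>f. f \<in> H \<Longrightarrow> E (f t) (f ` Y)"
    and unique: "\<And>w Y1 Y2. E w Y1 \<Longrightarrow> E w Y2 \<Longrightarrow> Y1 = Y2"
    and Y: "finite Y" "x \<in> Y"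
  shows "finite (orbit H x)"
proof -
  define supp where "supp = (\<lambda>w. THE Y. E w Y)"
  have supp: "supp (f t) = f ` Y" if "f \<in> H" for f
    unfolding supp_def using E[OF that] unique by (intro the_equality)
  have "finite (\<Union>(supp ` orbit H t))"
    using supp Y(1) by (intro finite_UN_I orb) (auto simp: orbit_def)
  moreover have "orbit H x \<subseteq> \<Union>(supp ` orbit H t)"
    using supp Y(2) by (auto simp: orbit_def)
  ultimately show ?thesis by (rule finite_subset[rotated])
qed

lemma aut_prod_image:
  assumes f: "f \<in> cluster_auts S0" and Y: "Y \<subseteq> clusterAlg S0"
    and g: "\<And>x. x \<in> Y \<Longrightarrow> g (k x) x \<in> clusterAlg S0"
    and fg: "\<And>x. x \<in> Y \<Longrightarrow> f (g (k x) x) = g (k x) (f x)"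
  shows "f (\<Prod>x\<in>Y. g (k x) x) = (\<Prod>y\<in>f ` Y. g (k (inv_into Y f y)) y)"
proof -
  have inj: "inj_on f Y" using inj_on_subset[OF aut_inj_on[OF f] Y] .
  have "f (\<Prod>x\<in>Y. g (k x) x) = (\<Prod>x\<in>Y. f (g (k x) x))"
    using g by (intro aut_prod[OF f]) auto
  also have "\<dots> = (\<Prod>x\<in>Y. g (k (inv_into Y f (f x))) (f x))"
    using fg inj by (intro prod.cong) auto
  also have "\<dots> = (\<Prod>y\<in>f ` Y. g (k (inv_into Y f y)) y)"
    using inj by (simp add: prod.reindex)
  finally show ?thesis .
qed

section \<open>Bounding the fixed algebra by means of a stable basis\<close>

lemma fixed_alg_subset_if_finite_orbits:
  assumes basis: "qbasis (clusterAlg S0) W" and fW: "\<And>f. f \<in> H \<Longrightarrow> f ` W \<subseteq> W"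
    and fin: "\<And>t. t \<in> W \<Longrightarrow> finite (orbit H t) \<Longrightarrow> t \<in> clusterAlg S1"
  shows "fixed_alg S0 H \<subseteq> clusterAlg S1"
proof
  fix z assume "z \<in> fixed_alg S0 H"
  then obtain T and c :: "'a \<Rightarrow> rat" where T: "T \<subseteq> W" "\<And>t. t \<in> T \<Longrightarrow> finite (orbit H t)"
    "z = (\<Sum>t\<in>T. of_rat (c t) * t)"
    using fixed_alg_expansion[OF basis fW] by blast
  then show "z \<in> clusterAlg S1"
    using fin unfolding clusterAlg_def T(3)
    by (intro qalg_gen_sum qalg_gen.mult[OF qalg_gen.rat]) auto
qed

lemma fixed_alg_subset_monomial_basis:
  assumes W: "stable_monomial_basis S0 W" and uniq: "unique_expression S0 W"
    and orb: "\<And>z. z \<in> clvars S0 - clusterAlg S1 \<Longrightarrow> infinite (orbit H z)"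
  shows "fixed_alg S0 H \<subseteq> clusterAlg S1"
proof (rule fixed_alg_subset_if_finite_orbits)
  show "qbasis (clusterAlg S0) W" using W unfolding stable_monomial_basis_def by (elim conjE)
  have "\<forall>f\<in>cluster_auts S0. f ` W \<subseteq> W" using W unfolding stable_monomial_basis_def by (elim conjE)
  then show fW: "f ` W \<subseteq> W" if "f \<in> H" for f using aut_subgroup_auts[OF that] by simp
  fix t assume t: "t \<in> W" and fin: "finite (orbit H t)"
  have "\<forall>w\<in>W. \<exists>Y k. monomial_expr (clvars S0) w Y k"
    using W unfolding stable_monomial_basis_def by (elim conjE)
  then obtain Y k where Yk: "monomial_expr (clvars S0) t Y k" using t by blast
  then have Y: "finite Y" "Y \<subseteq> clvars S0" "\<And>x. x \<in> Y \<Longrightarrow> k x > 0" "t = (\<Prod>x\<in>Y. x ^ k x)"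
    unfolding monomial_expr_def by auto
  have YA: "Y \<subseteq> clusterAlg S0" using Y(2) clvars_subset_clusterAlg[of S0] by auto
  \<comment> \<open>Membership in \<open>W\<close> is part of \<open>E\<close> because unique
    expression is granted only for basis elements.\<close>
  define E where "E = (\<lambda>w Y. w \<in> W \<and> (\<exists>k. monomial_expr (clvars S0) w Y k))"
  have "E (f t) (f ` Y)" if f: "f \<in> H" for f
  proof -
    note fa = aut_subgroup_auts[OF f]
    have "f t = (\<Prod>y\<in>f ` Y. y ^ k (inv_into Y f y))"
      unfolding Y(4) using YA
      by (intro aut_prod_image[OF fa YA, where g = "\<lambda>n x. x ^ n"])
         (auto simp: aut_power[OF fa] clusterAlg_def intro: qalg_gen_power)
    moreover have "f ` Y \<subseteq> clvars S0" using Y(2) aut_clvars[OF S0 fa] by auto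
    moreover have "k (inv_into Y f y) > 0" if "y \<in> f ` Y" for y
      using Y(3) that by (intro Y(3) inv_into_into)
    ultimately have "monomial_expr (clvars S0) (f t) (f ` Y) (\<lambda>y. k (inv_into Y f y))"
      using Y(1) by (simp add: monomial_expr_def)
    moreover have "f t \<in> W" using fW[OF f] t by auto
    ultimately show ?thesis unfolding E_def by auto
  qed
  moreover have "Y1 = Y2" if "E w Y1" "E w Y2" for w Y1 Y2
    using uniq that unfolding unique_expression_def E_def by blast
  ultimately have "finite (orbit H x)" if "x \<in> Y" for x
    using finite_orbit_of_support[of t E Y x] fin Y(1) that by blast
  then have "x \<in> clusterAlg S1" if "x \<in> Y" for x
    using orb[of x] Y(2) that by blast
  then show "t \<in> clusterAlg S1"
    unfolding Y(4) clusterAlg_def by (intro qalg_gen_prod qalg_gen_power)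
qed

lemma fixed_alg_subset_D_stable_basis:
  assumes W: "D_stable_basis S0 Cq D P"
    and orb: "\<And>z. z \<in> (clvars S0 \<union> Cq) - clusterAlg S1 \<Longrightarrow> infinite (orbit H z)"
  shows "fixed_alg S0 H \<subseteq> clusterAlg S1"
proof -
  note conds = W[unfolded D_stable_basis_def]
  have Cq: "Cq \<subseteq> clusterAlg S0"
    using conds by (elim conjE)
  have DU: "\<forall>U\<in>D. U \<subseteq> Cq \<union> clvars S0 \<and> (\<exists>S. reach S0 S \<and> U \<inter> clvars S0 \<subseteq> svar S ` sidx S)"
    using conds by (elim conjE)
  have P: "\<forall>k i. coeff (P k) i \<in> frozenRing S0"
    using conds by (elim conjE)
  have stab: "\<forall>f\<in>cluster_auts S0.
          (\<forall>k>0. \<forall>U\<in>D. \<forall>z\<in>U. f (bracket S0 P k z) = bracket S0 P k (f z)) \<and> (\<forall>U\<in>D. f ` U \<in> D)"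
    using conds by (elim conjE)
  have basis: "qbasis (clusterAlg S0) (Dbasis_elems S0 D P)"
    using conds by (elim conjE)
  have uniq: "\<forall>U1 U2 U1' U2' \<kappa>1 \<kappa>2. U1 \<in> D \<longrightarrow> U2 \<in> D \<longrightarrow> U1' \<subseteq> U1 \<longrightarrow> U2' \<subseteq> U2
          \<longrightarrow> finite U1' \<longrightarrow> finite U2' \<longrightarrow> (\<forall>x\<in>U1'. \<kappa>1 x > 0) \<longrightarrow> (\<forall>x\<in>U2'. \<kappa>2 x > 0)
          \<longrightarrow> (\<Prod>x\<in>U1'. bracket S0 P (\<kappa>1 x) x) = (\<Prod>x\<in>U2'. bracket S0 P (\<kappa>2 x) x)
          \<longrightarrow> U1' = U2'"
    using conds by (elim conjE)
  define E where "E = (\<lambda>w Y. \<exists>U \<kappa>. U \<in> D \<and> Y \<subseteq> U \<and> finite Y \<and> (\<forall>x\<in>Y. \<kappa> x > 0)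
      \<and> w = (\<Prod>x\<in>Y. bracket S0 P (\<kappa> x) x))"
  have elems: "w \<in> Dbasis_elems S0 D P \<longleftrightarrow> (\<exists>Y. E w Y)" for w
    unfolding Dbasis_elems_def E_def by blast
  have E_unique: "Y1 = Y2" if "E w Y1" "E w Y2" for w Y1 Y2
  proof -
    obtain U1 \<kappa>1 where 1: "U1 \<in> D" "Y1 \<subseteq> U1" "finite Y1" "\<forall>x\<in>Y1. \<kappa>1 x > 0"
      "w = (\<Prod>x\<in>Y1. bracket S0 P (\<kappa>1 x) x)" using \<open>E w Y1\<close> unfolding E_def by (elim exE conjE)
    obtain U2 \<kappa>2 where 2: "U2 \<in> D" "Y2 \<subseteq> U2" "finite Y2" "\<forall>x\<in>Y2. \<kappa>2 x > 0"
      "w = (\<Prod>x\<in>Y2. bracket S0 P (\<kappa>2 x) x)" using \<open>E w Y2\<close> unfolding E_def by (elim exE conjE)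
    show ?thesis
      using uniq[rule_format, OF 1(1) 2(1) 1(2) 2(2) 1(3) 2(3), of \<kappa>1 \<kappa>2] 1(4,5) 2(4,5) by simp
  qed
  \<comment> \<open>Stated for a general \<open>G\<close>, as it is applied both to the cluster
    variables of \<open>S0\<close> and to those of \<open>S1\<close>.\<close>
  have bracket_in: "bracket S0 P n x \<in> qalg_gen G"
    if "svar S0 ` sfr S0 \<subseteq> qalg_gen G" "x \<in> qalg_gen G" for n x G
  proof -
    have "coeff (P n) i \<in> qalg_gen G" for i
      using P qalg_gen_least[OF that(1)] unfolding frozenRing_def by auto
    then show ?thesis
      using that(2) by (simp add: bracket_def qalg_gen_power qalg_gen_poly)
  qed
  have frozen_clvars: "svar S0 ` sfr S0 \<subseteq> clvars S0"
    using svar_in_clvars[OF reach.refl, of _ S0] by (auto simp: sidx_def)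
  have UA: "U \<subseteq> clusterAlg S0" if "U \<in> D" for U
    using DU that Cq clvars_subset_clusterAlg[of S0] by blast
  have E_aut: "E (f t) (f ` Y)" if f: "f \<in> cluster_auts S0" and t: "E t Y" for f t Y
  proof -
    obtain U \<kappa> where U: "U \<in> D" "Y \<subseteq> U" "finite Y" "\<forall>x\<in>Y. \<kappa> x > 0"
      and t_eq: "t = (\<Prod>x\<in>Y. bracket S0 P (\<kappa> x) x)" using t unfolding E_def by (elim exE conjE)
    have YA: "Y \<subseteq> clusterAlg S0" using UA[OF U(1)] U(2) by blast
    have "f t = (\<Prod>y\<in>f ` Y. bracket S0 P (\<kappa> (inv_into Y f y)) y)"
      unfolding t_eq
    proof (rule aut_prod_image[OF f YA, where g = "bracket S0 P"])
      show "bracket S0 P (\<kappa> x) x \<in> clusterAlg S0" if "x \<in> Y" for x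
        using bracket_in[of "clvars S0" x] frozen_clvars clvars_subset_clusterAlg[of S0] YA that
        unfolding clusterAlg_def by auto
      show "f (bracket S0 P (\<kappa> x) x) = bracket S0 P (\<kappa> x) (f x)" if "x \<in> Y" for x
        using bspec[OF stab f] U that by auto
    qed
    moreover have "f ` U \<in> D" using bspec[OF stab f] U(1) by simp
    moreover have "\<forall>y\<in>f ` Y. \<kappa> (inv_into Y f y) > 0"
      using U(4) inv_into_into[of _ f Y] by auto
    ultimately show ?thesis
      unfolding E_def using U(2,3)
      by (intro exI[of _ "f ` U"] exI[of _ "\<lambda>y. \<kappa> (inv_into Y f y)"]) auto
  qed
  \<comment> \<open>This places the coefficients of every \<open>P k\<close> in
    \<open>clusterAlg S1\<close>, so that brackets of elements of this algebra stay inside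
    it.\<close>
  have frozen: "svar S0 ` sfr S0 \<subseteq> clusterAlg S1"
  proof
    fix x assume x: "x \<in> svar S0 ` sfr S0"
    have "orbit H x \<subseteq> svar S0 ` sfr S0"
      using aut_frozen[OF S0 aut_subgroup_auts x] by (auto simp: orbit_def)
    moreover have "finite (svar S0 ` sfr S0)" using S0 by (simp add: is_seed_def)
    ultimately have "finite (orbit H x)" by (rule finite_subset)
    then show "x \<in> clusterAlg S1" using orb[of x] frozen_clvars x by blast
  qed
  show ?thesis
  proof (rule fixed_alg_subset_if_finite_orbits[OF basis])
    show "f ` Dbasis_elems S0 D P \<subseteq> Dbasis_elems S0 D P" if "f \<in> H" for f
    proof
      fix w assume "w \<in> f ` Dbasis_elems S0 D P"
      then obtain t Y where "w = f t" "E t Y" using elems by blast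
      then show "w \<in> Dbasis_elems S0 D P" using E_aut[OF aut_subgroup_auts[OF that]] elems by auto
    qed
    fix t assume t: "t \<in> Dbasis_elems S0 D P" and fin: "finite (orbit H t)"
    then obtain Y where Y: "E t Y" using elems by blast
    then obtain U \<kappa> where U: "U \<in> D" "Y \<subseteq> U" "finite Y"
      and t_eq: "t = (\<Prod>x\<in>Y. bracket S0 P (\<kappa> x) x)" unfolding E_def by (elim exE conjE)
    have x: "x \<in> clusterAlg S1" if "x \<in> Y" for x
    proof -
      have "finite (orbit H x)"
        using fin E_aut[OF aut_subgroup_auts Y] E_unique U(3) that by (rule finite_orbit_of_support)
      moreover have "x \<in> clvars S0 \<union> Cq" using DU U that by blast
      ultimately show ?thesis using orb[of x] by blast
    qed
    show "t \<in> clusterAlg S1"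
      unfolding t_eq clusterAlg_def
      by (intro qalg_gen_prod bracket_in) (use frozen x in \<open>auto simp: clusterAlg_def\<close>)
  qed
qed

end

theorem theoremB:
  fixes S0 S1 :: "('i, 'a::field_char_0) seed" and H :: "('a \<Rightarrow> 'a) set"
  assumes seed: "is_seed S0"
    and subgrp: "aut_subgroup S0 H"
    and sub: "is_cluster_subalgebra S0 (clusterAlg S1)"
    and inv: "clusterAlg S1 \<subseteq> fixed_alg S0 H"
    and maximal: "\<forall>B. is_cluster_subalgebra S0 B \<longrightarrow> clusterAlg S1 \<subseteq> B
                       \<longrightarrow> B \<subseteq> fixed_alg S0 H \<longrightarrow> B = clusterAlg S1"
  shows "(fixed_alg S0 H = clusterAlg S1 \<longrightarrow>
            (\<forall>z \<in> clusterAlg S0 - clusterAlg S1. pos_laurent S0 z \<longrightarrow> infinite (orbit H z)))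
       \<and> (((\<exists>W. stable_monomial_basis S0 W \<and> unique_expression S0 W)
              \<and> (\<forall>z \<in> clvars S0 - clusterAlg S1. infinite (orbit H z)))
           \<or> (\<exists>Cq D P. D_stable_basis S0 Cq D P
              \<and> (\<forall>z \<in> (clvars S0 \<union> Cq) - clusterAlg S1. infinite (orbit H z)))
          \<longrightarrow> fixed_alg S0 H = clusterAlg S1)"
proof (intro conjI impI ballI notI)
  fix z assume fixed: "fixed_alg S0 H = clusterAlg S1" and z: "z \<in> clusterAlg S0 - clusterAlg S1"
    and fin: "finite (orbit H z)"
  \<comment> \<open>Only the algebra of \<open>S1\<close> is tied to \<open>S0\<close>, so
    \<open>S1\<close> is replaced by a subseed with the same algebra. Its cluster, indexed by
    \<open>sidx S - I1\<close>, is part of an extended cluster reachable from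
    \<open>S0\<close>.\<close>
  obtain S' where "is_cluster_subseed S0 S'" and S1: "clusterAlg S1 = clusterAlg S'"
    using sub unfolding is_cluster_subalgebra_def by blast
  then obtain S I0 I1 where S: "reach S0 S" and I: "I0 \<subseteq> sex S" "I0 \<inter> I1 = {}"
    and S': "S' = subseed S I0 I1"
    unfolding is_cluster_subseed_def by blast
  have idx: "sidx S' = sidx S - I1" "svar S' = svar S"
    unfolding S' using sidx_subseed[OF I] by simp_all
  have "z \<in> fixed_alg S0 H"
  proof (rule finite_orbit_in_fixed_alg[OF seed subgrp S])
    show "fixed_alg S0 H \<subseteq> qfield_gen (svar S ` (sidx S - I1))"
      using clusterAlg_subset_qfield_gen[of S'] unfolding fixed S1 idx .
    show "svar S ` (sidx S - I1) \<subseteq> fixed_alg S0 H"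
      using svar_in_clvars[OF reach.refl, of _ S'] clvars_subset_clusterAlg[of S']
      unfolding fixed S1 idx by auto
  qed (use z fin in auto)
  then show False using fixed z by simp
next
  assume "((\<exists>W. stable_monomial_basis S0 W \<and> unique_expression S0 W)
              \<and> (\<forall>z \<in> clvars S0 - clusterAlg S1. infinite (orbit H z)))
           \<or> (\<exists>Cq D P. D_stable_basis S0 Cq D P
              \<and> (\<forall>z \<in> (clvars S0 \<union> Cq) - clusterAlg S1. infinite (orbit H z)))"
  then have "fixed_alg S0 H \<subseteq> clusterAlg S1"
  proof (elim disjE conjE exE)
    fix W assume "stable_monomial_basis S0 W" "unique_expression S0 W"
      "\<forall>z \<in> clvars S0 - clusterAlg S1. infinite (orbit H z)"
    then show ?thesis by (intro fixed_alg_subset_monomial_basis[OF seed subgrp]) auto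
  next
    fix Cq D P assume "D_stable_basis S0 Cq D P"
      "\<forall>z \<in> (clvars S0 \<union> Cq) - clusterAlg S1. infinite (orbit H z)"
    then show ?thesis by (intro fixed_alg_subset_D_stable_basis[OF seed subgrp]) auto
  qed
  then show "fixed_alg S0 H = clusterAlg S1" using inv by simp
qed

end
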